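(* Let $\Omega_1>0$ and $\alpha>0$ be constants and let the angular velocity be $\Omega(\varepsilon)=\Omega_1/\varepsilon^{1+\alpha}$. Then, as $\varepsilon\to0^+$, $$\varepsilon^{2+2\alpha}E^{\mathrm{GP}}_\varepsilon=E^{\mathrm{TF}}_\varepsilon+O(\varepsilon^{2\alpha})+O(\varepsilon^2|\log\varepsilon|),$$ i.e. there exist $C>0$ and $\varepsilon_0>0$, independent of $\varepsilon$, such that $|\varepsilon^{2+2\alpha}E^{\mathrm{GP}}_\varepsilon-E^{\mathrm{TF}}_\varepsilon|\le C(\varepsilon^{2\alpha}+\varepsilon^2|\log\varepsilon|)$ for all $0<\varepsilon<\varepsilon_0$.
   Context: $\mathcal{B}_1\subset\mathbb{R}^2$ is the unit disc centered at the origin, $d\vec r$ is two-dimensional Lebesgue measure, $r=|\vec r|$, and $L=-i\partial_\vartheta$ in polar coordinates $(r,\vartheta)$. For $\varepsilon>0$ and angular velocity $\Omega(\varepsilon)$, the Gross-Pitaevskii (GP) functional on complex-valued $\Psi\in H^1(\mathcal{B}_1)$ is $$\mathcal{E}^{\mathrm{GP}}[\Psi]=\int_{\mathcal{B}_1}d\vec r\,\Big\{|\nabla\Psi|^2-\Omega(\varepsilon)\Psi^*L\Psi+\frac{|\Psi|^4}{\varepsilon^2}\Big\},$$ and $E^{\mathrm{GP}}_\varepsilon=\min\{\mathcal{E}^{\mathrm{GP}}[\Psi]:\Psi\in H^1(\mathcal{B}_1),\ \|\Psi\|_{L^2(\mathcal{B}_1)}=1\}$ (a minimizer exists). The Thomas-Fermi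 functional in this regime is $$\mathcal{E}^{\mathrm{TF}}_\varepsilon[\rho]=\varepsilon^{2\alpha}\int_{\mathcal{B}_1}d\vec r\,\Big\{\rho^2-\frac{\Omega_1^2r^2\rho}{4\varepsilon^{2\alpha}}\Big\},$$ defined on $\{\rho\in L^2(\mathcal{B}_1):\rho\ge0\}$, and $E^{\mathrm{TF}}_\varepsilon$ is its minimum over all such $\rho$ with $\int_{\mathcal{B}_1}\rho\,d\vec r=1$. For $\varepsilon$ small, $E^{\mathrm{TF}}_\varepsilon=-\frac{\Omega_1^2}{4}\big(1-\frac{8\varepsilon^\alpha}{3\sqrt\pi\,\Omega_1}\big)$. *)

theory Defs
  imports "HOL-Analysis.Analysis"
begin

primrec C_k :: "nat \<Rightarrow> (real^'n \<Rightarrow> real) \<Rightarrow> bool" where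
  "C_k 0 f \<longleftrightarrow> continuous_on UNIV f"
| "C_k (Suc k) f \<longleftrightarrow>
     (\<forall>x. f differentiable (at x)) \<and>
     (\<forall>i. C_k k (\<lambda>x. frechet_derivative f (at x) (axis i 1)))"

definition test_function :: "(real^'n) set \<Rightarrow> (real^'n \<Rightarrow> real) \<Rightarrow> bool" where
  "test_function S \<phi> \<longleftrightarrow>
     (\<forall>k. C_k k \<phi>) \<and> compact (closure {x. \<phi> x \<noteq> 0}) \<and> closure {x. \<phi> x \<noteq> 0} \<subseteq> S"

definition L2_on :: "(real^'n) set \<Rightarrow> (real^'n \<Rightarrow> 'b::euclidean_space) \<Rightarrow> bool" where
  "L2_on S f \<longleftrightarrow>
     f \<in> borel_measurable (lebesgue_on S) \<and> integrable (lebesgue_on S) (\<lambda>x. (norm (f x))\<^sup>2)"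

definition L2_norm_on :: "(real^'n) set \<Rightarrow> (real^'n \<Rightarrow> 'b::euclidean_space) \<Rightarrow> real" where
  "L2_norm_on S f = sqrt (LINT x|lebesgue_on S. (norm (f x))\<^sup>2)"

definition has_weak_gradient_on ::
  "(real^'n) set \<Rightarrow> (real^'n \<Rightarrow> complex) \<Rightarrow> (real^'n \<Rightarrow> complex^'n) \<Rightarrow> bool" where
  "has_weak_gradient_on S \<Psi> G \<longleftrightarrow>
     (\<forall>\<phi> i. test_function S \<phi> \<longrightarrow>
        (LINT x|lebesgue_on S. \<Psi> x * complex_of_real (frechet_derivative \<phi> (at x) (axis i 1))) =
        - (LINT x|lebesgue_on S. G x $ i * complex_of_real (\<phi> x)))"

text \<open>
  \<open>H1_on S \<Psi> G\<close> says that \<open>\<Psi>\<close> is in the Sobolev space \<open>H\<^sup>1(S)\<close> and that \<open>G\<close>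
  represents its weak gradient. As usual \<open>G\<close> is determined by \<open>\<Psi>\<close> up to null sets, so
  quantities that are integrals over \<open>S\<close> do not depend on the representative.
\<close>

definition H1_on ::
  "(real^'n) set \<Rightarrow> (real^'n \<Rightarrow> complex) \<Rightarrow> (real^'n \<Rightarrow> complex^'n) \<Rightarrow> bool" where
  "H1_on S \<Psi> G \<longleftrightarrow> L2_on S \<Psi> \<and> L2_on S G \<and> has_weak_gradient_on S \<Psi> G"

abbreviation unit_disc :: "(real^2) set" where
  "unit_disc \<equiv> ball 0 1"

text \<open>
  \<open>L = -i \<partial>\<^sub>\<theta>\<close> in Cartesian form, \<open>\<partial>\<^sub>\<theta> = x\<^sub>1 \<partial>\<^sub>2 - x\<^sub>2 \<partial>\<^sub>1\<close>, which makes sense for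
  weak gradients; \<open>g\<close> is the value of the gradient at \<open>x\<close>.
  The next lemma checks the agreement with the polar form for differentiable functions.
\<close>

definition ang_mom :: "real^2 \<Rightarrow> complex^2 \<Rightarrow> complex" where
  "ang_mom x g = - \<i> * (complex_of_real (x $ 1) * g $ 2 - complex_of_real (x $ 2) * g $ 1)"

lemma ang_mom_polar:
  fixes \<Psi> :: "real^2 \<Rightarrow> complex" and r \<theta> :: real
  defines "p \<equiv> \<lambda>t. vector [r * cos t, r * sin t] :: real^2"
  assumes "(\<Psi> has_derivative D) (at (p \<theta>))"
  shows "((\<lambda>t. - \<i> * \<Psi> (p t)) has_vector_derivative
            ang_mom (p \<theta>) (\<chi> i. D (axis i 1))) (at \<theta>)"
proof -
  have p_eq: "p t = (r * cos t) *\<^sub>R axis 1 1 + (r * sin t) *\<^sub>R axis 2 1" for t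
    by (simp add: p_def vec_eq_iff forall_2 axis_def)
  have dp: "(p has_vector_derivative
       ((- r * sin \<theta>) *\<^sub>R axis 1 1 + (r * cos \<theta>) *\<^sub>R axis 2 1)) (at \<theta>)"
    unfolding p_eq[abs_def]
    by (auto intro!: derivative_eq_intros simp: has_real_derivative_iff_has_vector_derivative[symmetric] mult.commute)
  have lin: "linear D"
    using assms(2) by (rule has_derivative_linear)
  have "((\<lambda>t. \<Psi> (p t)) has_vector_derivative
       D ((- r * sin \<theta>) *\<^sub>R axis 1 1 + (r * cos \<theta>) *\<^sub>R axis 2 1)) (at \<theta>)"
    using vector_derivative_diff_chain_within[OF dp, of \<Psi> D] assms(2)
    by (simp add: o_def has_derivative_at_withinI)
  then have "((\<lambda>t. - \<i> * \<Psi> (p t)) has_vector_derivative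
       - \<i> * D ((- r * sin \<theta>) *\<^sub>R axis 1 1 + (r * cos \<theta>) *\<^sub>R axis 2 1)) (at \<theta>)"
    by (rule has_vector_derivative_mult_right)
  moreover have D_eq: "D ((- r * sin \<theta>) *\<^sub>R axis 1 1 + (r * cos \<theta>) *\<^sub>R axis 2 1) =
      (- r * sin \<theta>) *\<^sub>R D (axis 1 1) + (r * cos \<theta>) *\<^sub>R D (axis 2 1)"
    by (simp only: linear_add[OF lin] linear_cmul[OF lin])
  moreover have "- \<i> * ((- r * sin \<theta>) *\<^sub>R D (axis 1 1) + (r * cos \<theta>) *\<^sub>R D (axis 2 1)) =
      ang_mom (p \<theta>) (\<chi> i. D (axis i 1))"
    by (simp add: ang_mom_def p_def scaleR_conv_of_real algebra_simps)
  ultimately show ?thesis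
    by (simp only: D_eq)
qed

text \<open>
  The integral is real because \<open>L\<close> is symmetric on the disc, so taking \<open>Re\<close> only changes its
  type. The integrand is integrable because \<open>H\<^sup>1\<close> embeds into \<open>L\<^sup>4\<close> on the disc.
\<close>

definition GP_functional ::
  "real \<Rightarrow> real \<Rightarrow> (real^2 \<Rightarrow> complex) \<Rightarrow> (real^2 \<Rightarrow> complex^2) \<Rightarrow> real" where
  "GP_functional \<Omega> \<epsilon> \<Psi> G =
     Re (LINT x|lebesgue_on unit_disc.
           complex_of_real ((norm (G x))\<^sup>2)
           - complex_of_real \<Omega> * (cnj (\<Psi> x) * ang_mom x (G x))
           + complex_of_real (cmod (\<Psi> x) ^ 4 / \<epsilon>\<^sup>2))"

text \<open>
  The ground state energies are minima; they are written as infima, which agree with the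
  minima since these are attained.
\<close>

definition GP_energy :: "real \<Rightarrow> real \<Rightarrow> real" where
  "GP_energy \<Omega> \<epsilon> =
     Inf {GP_functional \<Omega> \<epsilon> \<Psi> G | \<Psi> G. H1_on unit_disc \<Psi> G \<and> L2_norm_on unit_disc \<Psi> = 1}"

definition TF_functional :: "real \<Rightarrow> real \<Rightarrow> real \<Rightarrow> (real^2 \<Rightarrow> real) \<Rightarrow> real" where
  "TF_functional \<Omega>\<^sub>1 \<alpha> \<epsilon> \<rho> =
     \<epsilon> powr (2 * \<alpha>) *
     (LINT x|lebesgue_on unit_disc.
        (\<rho> x)\<^sup>2 - \<Omega>\<^sub>1\<^sup>2 * (norm x)\<^sup>2 * \<rho> x / (4 * \<epsilon> powr (2 * \<alpha>)))"

definition TF_energy :: "real \<Rightarrow> real \<Rightarrow> real \<Rightarrow> real" where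
  "TF_energy \<Omega>\<^sub>1 \<alpha> \<epsilon> =
     Inf {TF_functional \<Omega>\<^sub>1 \<alpha> \<epsilon> \<rho> | \<rho>.
            L2_on unit_disc \<rho> \<and> (AE x in lebesgue_on unit_disc. 0 \<le> \<rho> x) \<and>
            (LINT x|lebesgue_on unit_disc. \<rho> x) = 1}"

end

theory Submission imports Defs begin

text \<open>
  Lower bound: completing the square, \<open>\<bar>\<nabla>\<Psi>\<bar>\<^sup>2 - \<Omega> \<Psi>* L\<Psi> = \<bar>\<nabla>\<Psi> - iA\<Psi>\<bar>\<^sup>2 - \<Omega>\<^sup>2 r\<^sup>2 \<bar>\<Psi>\<bar>\<^sup>2 / 4\<close>, so the rescaled
  GP energy of \<open>\<Psi>\<close> is at least the TF energy of \<open>\<bar>\<Psi>\<bar>\<^sup>2\<close>.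

  Upper bound: the TF density \<open>q\<close> is supported on an annulus of thickness \<open>O(\<epsilon>\<^sup>\<alpha>)\<close> at the boundary, so a
  giant vortex \<open>f(r\<^sup>2) e\<^sup>i\<^sup>n\<^sup>\<theta>\<close> with \<open>n = \<lfloor>\<Omega>/2\<rfloor>\<close> suffices: there \<open>(n/r - \<Omega>r/2)\<^sup>2 = O(1 + \<Omega>\<^sup>2 \<epsilon>\<^sup>2\<^sup>\<alpha>)\<close>, which
  contributes \<open>O(\<epsilon>\<^sup>2\<^sup>\<alpha>)\<close> after rescaling. Regularising \<open>\<surd>q\<close> at the inner edge on the relative scale \<open>\<epsilon>\<close>
  costs \<open>O(\<epsilon>\<^sup>2 \<bar>log \<epsilon>\<bar>)\<close> in gradient energy, and \<open>\<epsilon>\<^sup>2\<^sup>\<alpha> \<integral> (f\<^sup>2 - q)\<^sup>2 = O(\<epsilon>\<^sup>2)\<close> in TF energy. All integrals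
  of radial functions are one-dimensional because \<open>\<bar>x\<bar>\<^sup>2\<close> is uniformly distributed on the disc.
\<close>

section \<open>Radial integrals and weak gradients\<close>

lemma borel_measurable_lebesgue_onI:
  "f \<in> borel_measurable borel \<Longrightarrow> f \<in> borel_measurable (lebesgue_on S)"
  by (intro measurable_restrict_space1 measurable_completion) simp

text \<open>A measure that is finite on the rays \<open>{u<..}\<close> is determined by its values
  there. For 0 <= u < 1 such a ray pulls back to the disc minus the closed disc of radius
  \<open>sqrt u\<close>, whose area pi (1 - u) is linear in u.\<close>

lemma distr_norm_square_unit_disc:
  "distr (lebesgue_on unit_disc) borel (\<lambda>x. (norm x)\<^sup>2) =
   density lborel (\<lambda>u. ennreal (pi * indicator {0<..<1} u))"
proof (rule measure_eqI_lessThan)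
  let ?M = "distr (lebesgue_on unit_disc) borel (\<lambda>x. (norm x)\<^sup>2)"
  let ?N = "density lborel (\<lambda>u. ennreal (pi * indicator {0<..<1} u))"
  have vol: "emeasure lborel (cball (0::real^2) r) = pi * r\<^sup>2" if "r \<ge> 0" for r
    using that by (simp add: emeasure_cball unit_ball_vol_2)
  have vol1: "emeasure lborel unit_disc = pi"
    by (simp add: emeasure_ball unit_ball_vol_2)
  have N: "emeasure ?N {u<..} = ennreal (pi * (1 - min 1 (max 0 u)))" for u
  proof -
    have "emeasure ?N {u<..} =
        (\<integral>\<^sup>+x. ennreal pi * indicator {max 0 u<..<1} x \<partial>lborel)"
      by (subst emeasure_density, simp, simp, intro nn_integral_cong)
         (auto simp: indicator_def)
    also have "\<dots> = ennreal pi * ennreal (1 - min 1 (max 0 u))"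
      by (subst nn_integral_cmult_indicator) (auto simp: max_def min_def)
    finally show ?thesis by (simp add: ennreal_mult')
  qed
  have M: "emeasure ?M {u<..} = ennreal (pi * (1 - min 1 (max 0 u)))" for u
  proof -
    have "emeasure ?M {u<..} =
        emeasure (lebesgue_on unit_disc) ((\<lambda>x. (norm x)\<^sup>2) -` {u<..} \<inter> unit_disc)"
      by (subst emeasure_distr) (auto intro!: borel_measurable_lebesgue_onI)
    also have "\<dots> = emeasure lborel ((\<lambda>x::real^2. (norm x)\<^sup>2) -` {u<..} \<inter> unit_disc)"
    proof -
      have "(\<lambda>x::real^2. (norm x)\<^sup>2) -` {u<..} \<inter> unit_disc \<in> sets borel"
        by (intro sets.Int measurable_sets_borel[where M=borel]) auto
      then show ?thesis by (subst emeasure_restrict_space) auto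
    qed
    also have "\<dots> = ennreal (pi * (1 - min 1 (max 0 u)))"
    proof -
      consider "u < 0" | "0 \<le> u" "u < 1" | "u \<ge> 1" by linarith
      then show ?thesis
      proof cases
        case 1
        then have "(\<lambda>x::real^2. (norm x)\<^sup>2) -` {u<..} \<inter> unit_disc = unit_disc"
          by (auto intro: order_less_le_trans zero_le_power2)
        with 1 show ?thesis by (simp add: vol1 max_def)
      next
        case 2
        have "u < (norm x)\<^sup>2 \<longleftrightarrow> x \<notin> cball 0 (sqrt u)" for x :: "real^2"
          using 2 by (metis dist_0_norm linorder_not_le mem_cball norm_ge_zero real_le_lsqrt
              real_less_lsqrt real_less_rsqrt real_sqrt_less_iff real_sqrt_unique sqrt_le_D)
        then have eq: "(\<lambda>x::real^2. (norm x)\<^sup>2) -` {u<..} \<inter> unit_disc = unit_disc - cball 0 (sqrt u)"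
          by auto
        have "sqrt u < 1" using 2 by simp
        then have "cball 0 (sqrt u) \<subseteq> unit_disc" by (auto simp del: real_sqrt_lt_1_iff)
        then have "emeasure lborel (unit_disc - cball 0 (sqrt u)) = ennreal pi - ennreal (pi * u)"
          using 2 by (subst emeasure_Diff) (auto simp: vol vol1)
        with 2 show ?thesis unfolding eq by (simp add: ennreal_minus algebra_simps)
      next
        case 3
        have "norm x < 1 \<Longrightarrow> \<not> u < (norm x)\<^sup>2" for x :: "real^2"
          using 3 power_le_one[of "norm x" 2] by auto
        then have "(\<lambda>x::real^2. (norm x)\<^sup>2) -` {u<..} \<inter> unit_disc = {}" by auto
        with 3 show ?thesis by simp
      qed
    qed
    finally show ?thesis .
  qed
  show "emeasure ?M {u<..} = emeasure ?N {u<..}" for u unfolding M N ..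
  show "emeasure ?M {u<..} < \<infinity>" for u unfolding M by simp
qed simp_all

lemma lebesgue_integral_radial:
  fixes g :: "real \<Rightarrow> real"
  assumes [measurable]: "g \<in> borel_measurable borel"
  shows "(LINT x|lebesgue_on unit_disc. g ((norm x)\<^sup>2)) = pi * (LBINT u:{0<..<1}. g u)"
proof -
  have "(LINT x|lebesgue_on unit_disc. g ((norm x)\<^sup>2)) =
      integral\<^sup>L (distr (lebesgue_on unit_disc) borel (\<lambda>x. (norm x)\<^sup>2)) g"
    by (rule integral_distr[symmetric]) (auto intro!: borel_measurable_lebesgue_onI)
  also have "\<dots> = (LINT u|lborel. (pi * indicator {0<..<1} u) *\<^sub>R g u)"
    unfolding distr_norm_square_unit_disc by (rule integral_density) auto
  also have "\<dots> = (LINT u|lborel. pi * (indicator {0<..<1} u *\<^sub>R g u))"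
    by (intro Bochner_Integration.integral_cong) (auto simp: indicator_def)
  also have "\<dots> = pi * (LBINT u:{0<..<1}. g u)"
    unfolding set_lebesgue_integral_def by simp
  finally show ?thesis .
qed

text \<open>The product of \<open>\<Psi>\<close> with a test function vanishes off a compact subset
  of \<open>S\<close>, and its i-th partial derivative is the sum of the two integrands. The claim
  is thus that this derivative has integral zero. As \<open>G\<close> is only measurable and
  bounded, the derivative is integrated by dominated convergence of difference quotients.\<close>

lemma weak_gradient_of_bounded_derivative:
  fixes \<Psi> :: "real^'n \<Rightarrow> complex" and G :: "real^'n \<Rightarrow> complex^'n"
  assumes S: "open S" "bounded S"
    and der: "\<And>x. x \<in> S \<Longrightarrow> (\<Psi> has_derivative (\<lambda>h. \<Sum>i\<in>UNIV. h $ i *\<^sub>R G x $ i)) (at x)"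
    and meas: "\<Psi> \<in> borel_measurable borel" "G \<in> borel_measurable borel"
    and bd: "\<And>x. x \<in> S \<Longrightarrow> norm (\<Psi> x) \<le> B" "\<And>x. x \<in> S \<Longrightarrow> norm (G x) \<le> B"
  shows "has_weak_gradient_on S \<Psi> G"
  unfolding has_weak_gradient_on_def
proof (intro allI impI)
  fix \<phi> :: "real^'n \<Rightarrow> real" and i
  assume tf: "test_function S \<phi>"
  define K where "K = closure {x. \<phi> x \<noteq> 0}"
  define d\<phi> where "d\<phi> = (\<lambda>x. frechet_derivative \<phi> (at x) (axis i 1))"
  have K: "compact K" "K \<subseteq> S" using tf by (auto simp: test_function_def K_def)
  have C1: "C_k 1 \<phi>" using tf by (auto simp: test_function_def)
  then have dif: "(\<phi> has_derivative frechet_derivative \<phi> (at x)) (at x)" for x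
    by (simp add: frechet_derivative_works)
  have cont: "continuous_on UNIV \<phi>" 
    using dif by (meson continuous_at_imp_continuous_on has_derivative_continuous)
  have dcont: "continuous_on UNIV d\<phi>" using C1 by (simp add: d\<phi>_def)
  have zero: "\<phi> x = 0" if "x \<notin> K" for x 
    using that closure_subset[of "{x. \<phi> x \<noteq> 0}"] by (auto simp: K_def)
  have dzero: "d\<phi> x = 0" if "x \<notin> K" for x
  proof -
    have "(\<phi> has_derivative (\<lambda>_. 0)) (at x)"
      by (rule has_derivative_transform_within_open[of "\<lambda>_. 0" _ _ _ "- K"])
         (use that K zero in \<open>auto simp: open_Compl compact_imp_closed\<close>)
    then have "frechet_derivative \<phi> (at x) = (\<lambda>_. 0)" by (rule frechet_derivative_at[symmetric])
    then show ?thesis unfolding d\<phi>_def by simp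
  qed
  have bounded: "\<exists>c. \<forall>x. \<bar>g x\<bar> \<le> c"
    if "continuous_on UNIV g" "\<And>x. x \<notin> K \<Longrightarrow> g x = 0" for g :: "real^'n \<Rightarrow> real"
  proof -
    have "bounded (g ` K)"
      using K(1) that(1) by (meson compact_continuous_image compact_imp_bounded continuous_on_subset subset_UNIV)
    then obtain c where "\<And>x. x \<in> K \<Longrightarrow> \<bar>g x\<bar> \<le> c" by (auto simp: bounded_iff)
    then have "\<bar>g x\<bar> \<le> max c 0" for x using that(2) by (cases "x \<in> K") (auto simp: le_max_iff_disj)
    then show ?thesis by blast
  qed
  obtain c where c: "\<And>x. \<bar>\<phi> x\<bar> \<le> c" using bounded[OF cont zero] by blast
  obtain c' where c': "\<And>x. \<bar>d\<phi> x\<bar> \<le> c'" using bounded[OF dcont dzero] by blast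
  have c0: "c \<ge> 0" "c' \<ge> 0" using c[of 0] c'[of 0] by linarith+
  have \<phi>m[measurable]: "\<phi> \<in> borel_measurable borel" "d\<phi> \<in> borel_measurable borel"
    using cont dcont by (auto intro: borel_measurable_continuous_onI)
  note [measurable] = meas
  have Gim[measurable]: "(\<lambda>x. G x $ i) \<in> borel_measurable borel"
    by (rule measurable_compose[OF meas(2)], intro borel_measurable_continuous_onI continuous_intros)
  define A where "A = (\<lambda>x. \<Psi> x * complex_of_real (d\<phi> x))"
  define A' where "A' = (\<lambda>x. G x $ i * complex_of_real (\<phi> x))"
  define F where "F = (\<lambda>x. \<Psi> x * complex_of_real (\<phi> x))"
  have [measurable]: "A \<in> borel_measurable borel" "A' \<in> borel_measurable borel"
    "F \<in> borel_measurable borel"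
    unfolding A_def A'_def F_def by measurable
  have B0: "B \<ge> 0" if "x \<in> K" for x using bd(1)[of x] that K(2) norm_ge_zero[of "\<Psi> x"] order_trans by blast
  \<comment> \<open>For empty \<open>S\<close> the bound \<open>B\<close> may be negative; the
    maximum keeps the dominating constant nonnegative.\<close>
  define E where "E = max 0 (B * (c + c'))"
  have bdA: "norm (A x) \<le> E * indicator K x" "norm (A' x) \<le> E * indicator K x" 
      "norm (A x + A' x) \<le> E * indicator K x" "norm (F x) \<le> E * indicator K x" for x
  proof -
    have *: "norm (A x) \<le> B * c' \<and> norm (A' x) \<le> B * c \<and> norm (F x) \<le> B * c" if "x \<in> K"
    proof -
      have "norm (G x $ i) \<le> B" using bd(2)[of x] that K(2) Finite_Cartesian_Product.norm_nth_le[of "G x" i] order_trans by blast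
      then show ?thesis unfolding A_def A'_def F_def norm_mult norm_of_real
        using bd(1)[of x] that K(2) c[of x] c'[of x] B0[OF that] by (intro conjI mult_mono) auto
    qed
    have z: "A x = 0" "A' x = 0" "F x = 0" if "x \<notin> K"
      using zero[OF that] dzero[OF that] by (auto simp: A_def A'_def F_def)
    have E: "B * c' + B * c \<le> E" by (simp add: E_def algebra_simps)
    have "B * c \<ge> 0 \<and> B * c' \<ge> 0" if "x \<in> K" using B0[OF that] c0 by simp
    then show "norm (A x) \<le> E * indicator K x" "norm (A' x) \<le> E * indicator K x" 
      "norm (A x + A' x) \<le> E * indicator K x" "norm (F x) \<le> E * indicator K x"
      using * z E norm_triangle_ineq[of "A x" "A' x"] by (auto simp: indicator_def)
  qed
  have Kfin: "integrable lborel (\<lambda>x. E * indicator K x :: real)" if "compact K" for K :: "(real^'n) set"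
    using that by (auto intro!: emeasure_compact_finite borel_compact)
  have intA: "integrable lborel A" "integrable lborel A'" "integrable lborel F"
    using bdA Kfin[OF K(1)]
    by (auto intro!: Bochner_Integration.integrable_bound[OF Kfin[OF K(1)]] order_trans[OF bdA(1)]
        order_trans[OF bdA(2)] order_trans[OF bdA(4)])
  \<comment> \<open>\<open>\<Psi>\<close> is known to be differentiable only on \<open>S\<close>,
    but \<open>F\<close> vanishes on the open complement of \<open>K\<close>, so this derivative
    exists at every point.\<close>
  have dF: "((\<lambda>s. F (x + s *\<^sub>R axis i 1)) has_vector_derivative (A x + A' x)) (at 0)" for x
  proof (cases "x \<in> K")
    case True
    then have xS: "x \<in> S" using K by auto
    have "(F has_derivative (\<lambda>h. \<Psi> x * of_real (frechet_derivative \<phi> (at x) h) +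
        (\<Sum>j\<in>UNIV. h $ j *\<^sub>R G x $ j) * of_real (\<phi> x))) (at x)"
      unfolding F_def
      by (rule has_derivative_mult[OF der[OF xS]]) (intro has_derivative_of_real dif)
    then have "(F has_derivative (\<lambda>h. \<Psi> x * of_real (frechet_derivative \<phi> (at x) h) +
        (\<Sum>j\<in>UNIV. h $ j *\<^sub>R G x $ j) * of_real (\<phi> x))) (at (x + 0 *\<^sub>R axis i 1))" by simp
    then have "((\<lambda>s. F (x + s *\<^sub>R axis i 1)) has_derivative
       (\<lambda>s. \<Psi> x * of_real (frechet_derivative \<phi> (at x) (s *\<^sub>R axis i 1)) +
        (\<Sum>j\<in>UNIV. (s *\<^sub>R axis i 1) $ j *\<^sub>R G x $ j) * of_real (\<phi> x))) (at 0)"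
      by (rule has_derivative_compose[rotated]) (auto intro!: derivative_eq_intros)
    moreover have "\<Psi> x * of_real (frechet_derivative \<phi> (at x) (s *\<^sub>R axis i 1)) +
        (\<Sum>j\<in>UNIV. (s *\<^sub>R axis i 1) $ j *\<^sub>R G x $ j) * of_real (\<phi> x) = s *\<^sub>R (A x + A' x)" for s
    proof -
      have "frechet_derivative \<phi> (at x) (s *\<^sub>R axis i 1) = s * d\<phi> x"
        using dif[of x] has_derivative_linear linear_cmul unfolding d\<phi>_def by fastforce
      moreover have "(\<Sum>j\<in>UNIV. (s *\<^sub>R axis i 1) $ j *\<^sub>R G x $ j) = s *\<^sub>R G x $ i"
        by (subst sum.remove[of _ i]) (auto simp: axis_def intro!: sum.neutral)
      ultimately show ?thesis
        by (simp add: A_def A'_def scaleR_conv_of_real algebra_simps)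
    qed
    ultimately show ?thesis by (simp add: has_vector_derivative_def)
  next
    case False
    have "open ((\<lambda>s. x + s *\<^sub>R axis i 1) -` (- K))"
      using K by (intro open_vimage continuous_intros) (auto simp: compact_imp_closed)
    then have "((\<lambda>s. F (x + s *\<^sub>R axis i 1)) has_vector_derivative 0) (at 0)"
      using False zero
      by (rule_tac has_vector_derivative_transform_within_open[where f="\<lambda>_. 0"
          and S="(\<lambda>s. x + s *\<^sub>R axis i 1) -` (- K)"]) (simp_all add: F_def)
    then show ?thesis using zero[OF False] dzero[OF False] by (simp add: A_def A'_def)
  qed
  have dF': "((\<lambda>s. F (x + s *\<^sub>R axis i 1)) has_vector_derivative (A (x + t *\<^sub>R axis i 1) + A' (x + t *\<^sub>R axis i 1))) (at t)" for x t
  proof -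
    have "((\<lambda>s. F ((x + t *\<^sub>R axis i 1) + s *\<^sub>R axis i 1)) \<circ> (\<lambda>s. s - t) has_vector_derivative
        1 *\<^sub>R (A (x + t *\<^sub>R axis i 1) + A' (x + t *\<^sub>R axis i 1))) (at t)"
      by (rule vector_diff_chain_at) (use dF in \<open>auto intro!: derivative_eq_intros\<close>)
    then show ?thesis by (simp add: o_def algebra_simps flip: scaleR_left_distrib)
  qed
  have E0: "E \<ge> 0" by (simp add: E_def)
  \<comment> \<open>The mean value inequality bounds the difference quotients uniformly in the step
    size, which gives the domination.\<close>
  have lip: "norm (F (x + s *\<^sub>R axis i 1) - F x) \<le> E * \<bar>s\<bar>" for x s
  proof -
    have "norm ((\<lambda>s. F (x + s *\<^sub>R axis i 1)) s - (\<lambda>s. F (x + s *\<^sub>R axis i 1)) 0) \<le> E * norm (s - 0)"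
    proof (rule differentiable_bound[where S=UNIV and f'="\<lambda>t h. h *\<^sub>R (A (x + t *\<^sub>R axis i 1) + A' (x + t *\<^sub>R axis i 1))"])
      show "onorm (\<lambda>h. h *\<^sub>R (A (x + t *\<^sub>R axis i 1) + A' (x + t *\<^sub>R axis i 1))) \<le> E" for t
        using bdA(3)[of "x + t *\<^sub>R axis i 1"] E0
        by (subst onorm_scaleR_left)
          (auto simp: onorm_id intro: bounded_linear_ident split: split_indicator_asm)
    qed (use dF' in \<open>auto simp: has_vector_derivative_def\<close>)
    then show ?thesis by simp
  qed
  define h where "h = (\<lambda>k::nat. 1 / real (Suc k))"
  have h: "h k > 0" "h k \<le> 1" for k by (auto simp: h_def)
  have hlim: "h \<longlonglongrightarrow> 0" unfolding h_def by (rule lim_1_over_n[THEN LIMSEQ_Suc])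
  \<comment> \<open>Steps have length at most 1, so all difference quotients vanish outside this
    closed 1-neighbourhood of \<open>K\<close>.\<close>
  define K' where "K' = (\<lambda>(x,y). x + y) ` (K \<times> cball 0 1)"
  have K': "compact K'" unfolding K'_def
    by (intro compact_continuous_image compact_Times K(1) compact_cball) (auto intro!: continuous_intros simp: case_prod_unfold)
  define Q where "Q = (\<lambda>k x. (F (x + h k *\<^sub>R axis i 1) - F x) /\<^sub>R h k)"
  \<comment> \<open>The integral of a difference quotient of \<open>F\<close> vanishes by translation invariance, so no Fubini is needed.\<close>
  have "(\<lambda>k. LINT x|lborel. Q k x) \<longlonglongrightarrow> (LINT x|lborel. A x + A' x)"
  proof (rule integral_dominated_convergence[where w="\<lambda>x. E * indicator K' x"])
    show "AE x in lborel. (\<lambda>k. Q k x) \<longlonglongrightarrow> A x + A' x"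
    proof (rule AE_I2)
      fix x
      have "((\<lambda>s. (F (x + s *\<^sub>R axis i 1) - F x - s *\<^sub>R (A x + A' x)) /\<^sub>R \<bar>s\<bar>) \<longlongrightarrow> 0) (at 0)"
        using dF[of x] by (simp add: has_vector_derivative_def has_derivative_at_within)
      moreover have "filterlim h (at 0) sequentially"
        using hlim h by (auto simp: filterlim_at less_imp_neq[symmetric] intro!: always_eventually)
      ultimately have "(\<lambda>k. (F (x + h k *\<^sub>R axis i 1) - F x - h k *\<^sub>R (A x + A' x)) /\<^sub>R \<bar>h k\<bar>) \<longlonglongrightarrow> 0"
        by (rule filterlim_compose)
      moreover have "(F (x + h k *\<^sub>R axis i 1) - F x - h k *\<^sub>R (A x + A' x)) /\<^sub>R \<bar>h k\<bar> = Q k x - (A x + A' x)" for k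
        using h(1)[of k] by (simp add: Q_def scaleR_diff_right)
      ultimately show "(\<lambda>k. Q k x) \<longlonglongrightarrow> A x + A' x"
        by (simp add: LIM_zero_iff)
    qed
    show "AE x in lborel. norm (Q k x) \<le> E * indicator K' x" for k
    proof (rule AE_I2)
      fix x
      show "norm (Q k x) \<le> E * indicator K' x"
      proof (cases "x \<in> K'")
        case True
        have "norm (Q k x) = norm (F (x + h k *\<^sub>R axis i 1) - F x) / h k"
          using h[of k] by (simp add: Q_def divide_inverse_commute)
        with True show ?thesis using lip[of x "h k"] h[of k]
          by (simp add: divide_le_eq)
      next
        case False
        have "x \<notin> K"
        proof
          assume "x \<in> K" then have "(x, 0) \<in> K \<times> cball 0 1" by simp
          then have "x + 0 \<in> K'" unfolding K'_def by force
          with False show False by simp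
        qed
        moreover have "x + h k *\<^sub>R axis i 1 \<notin> K"
        proof
          assume "x + h k *\<^sub>R axis i 1 \<in> K"
          then have "(x + h k *\<^sub>R axis i 1, - h k *\<^sub>R axis i 1 :: real^'n) \<in> K \<times> cball 0 1"
            using h[of k] by (simp add: dist_norm)
          then have "x + h k *\<^sub>R axis i 1 + (- h k *\<^sub>R axis i 1) \<in> K'"
            unfolding K'_def by (rule rev_image_eqI) simp
          with False show False by simp
        qed
        ultimately show ?thesis using False zero by (simp add: Q_def F_def)
      qed
    qed
    show "integrable lborel (\<lambda>x. E * indicator K' x :: real)" by (rule Kfin[OF K'])
  qed (auto simp: Q_def)
  moreover have "(LINT x|lborel. Q k x) = 0" for k
  proof -
    have d: "distr lborel borel ((+) (h k *\<^sub>R axis i 1)) = (lborel :: (real^'n) measure)"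
      by (rule lborel_distr_plus)
    have i: "integrable lborel (\<lambda>x. F (x + h k *\<^sub>R axis i 1))"
      using integrable_distr_eq[of "(+) (h k *\<^sub>R axis i 1)" lborel borel F] intA(3)
      by (simp add: d add.commute)
    have "(LINT x|lborel. F (x + h k *\<^sub>R axis i 1)) = (LINT x|lborel. F x)"
      using integral_distr[of "(+) (h k *\<^sub>R axis i 1)" lborel borel F]
      by (simp add: d add.commute)
    then show ?thesis unfolding Q_def using i intA(3) by simp
  qed
  ultimately have "(LINT x|lborel. A x + A' x) = 0"
    by (simp add: LIMSEQ_const_iff)
  then have sum0: "(LINT x|lborel. A x) = - (LINT x|lborel. A' x)"
    using intA by (simp add: add_eq_0_iff2)
  have restr: "(LINT x|lebesgue_on S. f x) = (LINT x|lborel. f x)"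
    if [measurable]: "f \<in> borel_measurable borel" and "\<And>x. x \<notin> K \<Longrightarrow> f x = 0" for f :: "real^'n \<Rightarrow> complex"
  proof -
    have "(LINT x|lebesgue_on S. f x) = (LINT x|lebesgue. indicator S x *\<^sub>R f x)"
      using S by (intro integral_restrict_space) auto
    also have "\<dots> = (LINT x|lebesgue. f x)"
      using that(2) K(2) by (intro Bochner_Integration.integral_cong) (auto simp: indicator_def)
    also have "\<dots> = (LINT x|lborel. f x)"
      by (rule integral_completion) simp
    finally show ?thesis .
  qed
  have "(LINT x|lebesgue_on S. A x) = - (LINT x|lebesgue_on S. A' x)"
    using sum0 zero dzero by (subst (1 2) restr) (auto simp: A_def A'_def)
  then show "(LINT x|lebesgue_on S. \<Psi> x * complex_of_real (frechet_derivative \<phi> (at x) (axis i 1))) =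
        - (LINT x|lebesgue_on S. G x $ i * complex_of_real (\<phi> x))"
    unfolding A_def A'_def d\<phi>_def .
qed

section \<open>Giant vortices\<close>

definition cplx :: "real^2 \<Rightarrow> complex" where
  "cplx x = Complex (x $ 1) (x $ 2)"

text \<open>Off the origin \<open>sgn (cplx x)\<close> is the phase e^(i theta), so \<open>n\<close>
  is the winding number. The profile is a function of r^2, which is uniformly distributed on the
  disc.\<close>

definition vortex :: "(real \<Rightarrow> real) \<Rightarrow> nat \<Rightarrow> real^2 \<Rightarrow> complex" where
  "vortex f n x = complex_of_real (f ((norm x)\<^sup>2)) * sgn (cplx x) ^ n"

text \<open>With the phase factored out, the real parts are the gradient of f(r^2) and the imaginary
  parts are n f times the gradient (-x_2, x_1) / r^2 of the polar angle.\<close>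

definition vortex_grad :: "(real \<Rightarrow> real) \<Rightarrow> (real \<Rightarrow> real) \<Rightarrow> nat \<Rightarrow> real^2 \<Rightarrow> complex^2" where
  "vortex_grad f f' n x = vector
     [sgn (cplx x) ^ n * Complex (2 * x $ 1 * f' ((norm x)\<^sup>2)) (- real n * f ((norm x)\<^sup>2) * x $ 2 / (norm x)\<^sup>2),
      sgn (cplx x) ^ n * Complex (2 * x $ 2 * f' ((norm x)\<^sup>2)) (real n * f ((norm x)\<^sup>2) * x $ 1 / (norm x)\<^sup>2)]"

lemma norm_cplx [simp]: "cmod (cplx x) = norm x"
  by (simp add: cplx_def norm_complex_def norm_vec_def L2_set_def sum_2)

lemma norm_square_2: "(norm x)\<^sup>2 = (x $ 1)\<^sup>2 + (x $ 2)\<^sup>2" for x :: "real^2"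
  by (simp add: norm_vec_def L2_set_def sum_2)

lemma cplx_eq_0_iff [simp]: "cplx x = 0 \<longleftrightarrow> x = 0"
  by (metis norm_cplx norm_eq_zero)

lemma bounded_linear_cplx: "bounded_linear cplx"
  by (intro bounded_linear_intro[where K=1]) (simp_all, auto simp: cplx_def complex_eq_iff)

lemma norm_sgn_cplx_power: "x \<noteq> 0 \<Longrightarrow> norm (sgn (cplx x) ^ n) = 1"
  by (simp add: norm_power norm_sgn)

text \<open>This is d e^(i theta) = i e^(i theta) d theta, obtained by differentiating z / |z|, so
  that no branch of the angle has to be chosen.\<close>

lemma sgn_cplx_has_derivative:
  fixes x :: "real^2"
  assumes "x \<noteq> 0"
  shows "((\<lambda>x. sgn (cplx x)) has_derivative
           (\<lambda>h. sgn (cplx x) * (\<i> * of_real ((x $ 1 * h $ 2 - x $ 2 * h $ 1) / (norm x)\<^sup>2)))) (at x)"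
proof -
  have r: "norm x > 0" using assms by simp
  have 1: "(cplx has_derivative cplx) (at x)"
    by (rule bounded_linear_imp_has_derivative[OF bounded_linear_cplx])
  have "((\<lambda>x. inverse (norm x)) has_derivative
          (\<lambda>h. - (inverse (norm x) * inner (sgn x) h * inverse (norm x)))) (at x)"
    using assms
    by (intro Deriv.has_derivative_inverse has_derivative_eq_rhs[OF has_derivative_norm])
      (auto simp: inner_commute)
  then have 2: "((\<lambda>x. of_real (inverse (norm x)) :: complex) has_derivative
          (\<lambda>h. of_real (- (inverse (norm x) * inner (sgn x) h * inverse (norm x))))) (at x)"
    by (rule has_derivative_of_real)
  have "((\<lambda>x. cplx x * of_real (inverse (norm x))) has_derivative
      (\<lambda>h. cplx x * of_real (- (inverse (norm x) * inner (sgn x) h * inverse (norm x)))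
           + cplx h * of_real (inverse (norm x)))) (at x)"
    by (rule has_derivative_mult[OF 1 2])
  moreover have "cplx x * of_real (inverse (norm x)) = sgn (cplx x)" for x
    by (simp add: sgn_eq divide_inverse)
  moreover have "cplx x * of_real (- (inverse (norm x) * inner (sgn x) h * inverse (norm x)))
           + cplx h * of_real (inverse (norm x)) =
        sgn (cplx x) * (\<i> * of_real ((x $ 1 * h $ 2 - x $ 2 * h $ 1) / (norm x)\<^sup>2))" for h
  proof -
    have in_eq: "inner (sgn x) h = (x $ 1 * h $ 1 + x $ 2 * h $ 2) / norm x"
      by (simp add: inner_vec_def sum_2 sgn_div_norm divide_inverse algebra_simps)
    have *: "norm x * norm x = x $ 1 * x $ 1 + x $ 2 * x $ 2"
      using norm_square_2[of x] by (simp add: power2_eq_square)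
    define r where "r = norm x"
    have r0: "r > 0" and rr: "r * r = x $ 1 * x $ 1 + x $ 2 * x $ 2"
      using r * by (auto simp: r_def)
    \<comment> \<open>Extending the fraction by r^2 gives the terms the common denominator r^3,
      after which the components can be compared.\<close>
    have e: "v / r = v * (x $ 1 * x $ 1 + x $ 2 * x $ 2) / (r * r * r)" for v
      using r0 by (simp add: rr[symmetric])
    show ?thesis
      unfolding complex_eq_iff in_eq sgn_eq norm_cplx
      apply (simp add: cplx_def power2_eq_square divide_inverse flip: r_def)
      apply (simp add: divide_inverse[symmetric])
      using r0 e[of "h $ 1"] e[of "h $ 2"]
      apply (simp add: field_simps)
      done
  qed
  ultimately show ?thesis by simp
qed

text \<open>The phase is singular only at the origin, and there the vortex vanishes on the whole
  disc r^2 < a. Elsewhere the product and chain rules apply.\<close>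

lemma vortex_has_derivative:
  assumes f: "\<And>u. (f has_real_derivative f' u) (at u)"
    and a: "a > 0" "\<And>u. u \<le> a \<Longrightarrow> f u = 0" "\<And>u. u \<le> a \<Longrightarrow> f' u = 0"
  shows "(vortex f n has_derivative (\<lambda>h. \<Sum>i\<in>UNIV. h $ i *\<^sub>R vortex_grad f f' n x $ i)) (at x)"
proof (cases "x = 0")
  case True
  have "(vortex f n has_derivative (\<lambda>h. 0)) (at x)"
  proof (rule has_derivative_transform_within_open)
    show "open ((\<lambda>x::real^2. (norm x)\<^sup>2) -` {..<a})"
      by (intro open_vimage continuous_intros)
    show "0 = vortex f n y" if "y \<in> (\<lambda>x. (norm x)\<^sup>2) -` {..<a}" for y
      using that a(2) by (simp add: vortex_def)
  qed (use a True in auto)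
  moreover have "vortex_grad f f' n x = 0"
    using True a by (simp add: vortex_grad_def vec_eq_iff forall_2 complex_eq_iff)
  ultimately show ?thesis by simp
next
  case False
  let ?s = "sgn (cplx x)"
  let ?u = "(norm x)\<^sup>2"
  have 1: "((\<lambda>x. f ((norm x)\<^sup>2)) has_derivative (\<lambda>h. f' ?u * (2 * inner x h))) (at x)"
  proof -
    have "((\<lambda>x. (norm x)\<^sup>2) has_derivative (\<lambda>h. 2 * inner x h)) (at x)"
      unfolding power2_norm_eq_inner by (auto intro!: derivative_eq_intros simp: inner_commute)
    then show ?thesis using f[of ?u] 
      by (auto simp: has_field_derivative_def intro: has_derivative_compose[where g=f])
  qed
  note 2 = has_derivative_power[OF sgn_cplx_has_derivative[OF False], of n]
  have "(vortex f n has_derivative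
     (\<lambda>h. of_real (f ?u) * (of_nat n * (?s * (\<i> * of_real ((x $ 1 * h $ 2 - x $ 2 * h $ 1) / ?u))) * ?s ^ (n - 1))
       + of_real (f' ?u * (2 * inner x h)) * ?s ^ n)) (at x)"
    unfolding vortex_def[abs_def]
    by (rule has_derivative_mult[OF has_derivative_of_real[OF 1] 2])
  moreover have "of_real (f ?u) * (of_nat n * (?s * (\<i> * of_real ((x $ 1 * h $ 2 - x $ 2 * h $ 1) / ?u))) * ?s ^ (n - 1))
       + of_real (f' ?u * (2 * inner x h)) * ?s ^ n = (\<Sum>i\<in>UNIV. h $ i *\<^sub>R vortex_grad f f' n x $ i)" for h
  proof -
    \<comment> \<open>The power rule produces the truncated exponent \<open>n - 1\<close>; for
      \<open>n = 0\<close> the prefactor makes it harmless.\<close>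
    have s: "of_nat n * (?s * ?s ^ (n - 1)) = of_nat n * ?s ^ n" by (cases n) auto
    have "of_real (f ?u) * (of_nat n * (?s * (\<i> * of_real ((x $ 1 * h $ 2 - x $ 2 * h $ 1) / ?u))) * ?s ^ (n - 1)) =
       of_real (f ?u) * (of_nat n * (?s * ?s ^ (n - 1))) * (\<i> * of_real ((x $ 1 * h $ 2 - x $ 2 * h $ 1) / ?u))"
      by (simp only: mult_ac)
    also have "\<dots> = ?s ^ n * (\<i> * of_real (real n * f ?u * ((x $ 1 * h $ 2 - x $ 2 * h $ 1) / ?u)))"
      unfolding s by (simp add: mult_ac)
    finally have A: "of_real (f ?u) * (of_nat n * (?s * (\<i> * of_real ((x $ 1 * h $ 2 - x $ 2 * h $ 1) / ?u))) * ?s ^ (n - 1)) =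
       ?s ^ n * (\<i> * of_real (real n * f ?u * ((x $ 1 * h $ 2 - x $ 2 * h $ 1) / ?u)))" .
    have "of_real (f ?u) * (of_nat n * (?s * (\<i> * of_real ((x $ 1 * h $ 2 - x $ 2 * h $ 1) / ?u))) * ?s ^ (n - 1))
       + of_real (f' ?u * (2 * inner x h)) * ?s ^ n =
       ?s ^ n * Complex (f' ?u * (2 * inner x h)) (real n * f ?u * ((x $ 1 * h $ 2 - x $ 2 * h $ 1) / ?u))"
      unfolding A Complex_eq by (simp only: algebra_simps)
    also have "Complex (f' ?u * (2 * inner x h)) (real n * f ?u * ((x $ 1 * h $ 2 - x $ 2 * h $ 1) / ?u)) =
       h $ 1 *\<^sub>R Complex (2 * x $ 1 * f' ?u) (- real n * f ?u * x $ 2 / ?u) +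
       h $ 2 *\<^sub>R Complex (2 * x $ 2 * f' ?u) (real n * f ?u * x $ 1 / ?u)"
      by (simp add: complex_eq_iff inner_vec_def sum_2 algebra_simps diff_divide_distrib)
    finally show ?thesis
      by (simp add: sum_2 vortex_grad_def scaleR_conv_of_real algebra_simps)
  qed
  ultimately show ?thesis by simp
qed

lemma norm_vortex: 
  assumes "f 0 = 0"
  shows "(cmod (vortex f n x))\<^sup>2 = (f ((norm x)\<^sup>2))\<^sup>2"
  using assms norm_sgn_cplx_power[of x n]
  by (cases "x = 0") (simp_all add: vortex_def norm_mult)

text \<open>The phase has modulus one, and what remains has the radial derivative as real part and
  the angular one as imaginary part, so no cross term appears.\<close>

lemma norm_vortex_grad:
  assumes "f 0 = 0" "f' 0 = 0"
  shows "(norm (vortex_grad f f' n x))\<^sup>2 =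
    4 * (norm x)\<^sup>2 * (f' ((norm x)\<^sup>2))\<^sup>2 + (real n)\<^sup>2 * (f ((norm x)\<^sup>2))\<^sup>2 / (norm x)\<^sup>2"
proof (cases "x = 0")
  case True
  then show ?thesis using assms by (simp add: vortex_grad_def norm_vec_def L2_set_def sum_2 norm_mult complex_norm)
next
  case False
  let ?u = "(norm x)\<^sup>2"
  have u: "?u > 0" using False by simp
  have "(norm (vortex_grad f f' n x))\<^sup>2 =
     (2 * x $ 1 * f' ?u)\<^sup>2 + (real n * f ?u * x $ 2 / ?u)\<^sup>2 + ((2 * x $ 2 * f' ?u)\<^sup>2 + (real n * f ?u * x $ 1 / ?u)\<^sup>2)"
    using norm_sgn_cplx_power[OF False, of n]
    by (simp add: vortex_grad_def norm_vec_def L2_set_def sum_2 norm_mult complex_norm)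
  also have "\<dots> = 4 * ((x $ 1)\<^sup>2 + (x $ 2)\<^sup>2) * (f' ?u)\<^sup>2 + (real n)\<^sup>2 * (f ?u)\<^sup>2 * ((x $ 1)\<^sup>2 + (x $ 2)\<^sup>2) / (?u)\<^sup>2"
    by (simp add: power_mult_distrib power_divide add_divide_distrib algebra_simps)
  also have "\<dots> = 4 * ?u * (f' ?u)\<^sup>2 + (real n)\<^sup>2 * (f ?u)\<^sup>2 / ?u"
    using u unfolding norm_square_2[symmetric] by (simp add: power2_eq_square)
  finally show ?thesis .
qed

text \<open>A vortex is an eigenfunction of the angular momentum with eigenvalue \<open>n\<close>:
  the derivatives of the profile cancel in x_1 d_2 - x_2 d_1.\<close>

lemma ang_mom_vortex:
  assumes "f 0 = 0" 
  shows "cnj (vortex f n x) * ang_mom x (vortex_grad f f' n x) = of_real (real n * (f ((norm x)\<^sup>2))\<^sup>2)"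
proof (cases "x = 0")
  case True
  then show ?thesis using assms by (simp add: vortex_def)
next
  case False
  let ?s = "sgn (cplx x) ^ n"
  let ?u = "(norm x)\<^sup>2"
  have u: "?u > 0" using False by simp
  have s: "cnj ?s * ?s = 1"
    using norm_sgn_cplx_power[OF False, of n] by (metis complex_norm_square mult.commute of_real_1 power_one)
  have "ang_mom x (vortex_grad f f' n x) = ?s * (- \<i> * (of_real (x $ 1) * Complex (2 * x $ 2 * f' ?u) (real n * f ?u * x $ 1 / ?u)
     - of_real (x $ 2) * Complex (2 * x $ 1 * f' ?u) (- real n * f ?u * x $ 2 / ?u)))"
    by (simp add: ang_mom_def vortex_grad_def algebra_simps)
  also have "(- \<i> * (of_real (x $ 1) * Complex (2 * x $ 2 * f' ?u) (real n * f ?u * x $ 1 / ?u)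
     - of_real (x $ 2) * Complex (2 * x $ 1 * f' ?u) (- real n * f ?u * x $ 2 / ?u))) =
     of_real (real n * f ?u * (((x $ 1)\<^sup>2 + (x $ 2)\<^sup>2) / ?u))"
    by (simp add: complex_eq_iff power2_eq_square algebra_simps add_divide_distrib)
  also have "\<dots> = of_real (real n * f ?u)"
    using u unfolding norm_square_2[symmetric] by simp
  finally have "cnj (vortex f n x) * ang_mom x (vortex_grad f f' n x) =
      (cnj ?s * ?s) * of_real (f ?u * (real n * f ?u))"
    by (simp add: vortex_def)
  then show ?thesis unfolding s by (simp add: power2_eq_square mult_ac)
qed

lemma vortex_measurable:
  assumes [measurable]: "f \<in> borel_measurable borel" "f' \<in> borel_measurable borel"
  shows "vortex f n \<in> borel_measurable borel" "vortex_grad f f' n \<in> borel_measurable borel"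
proof -
  have [measurable]: "cplx \<in> borel_measurable borel"
    by (intro borel_measurable_continuous_onI linear_continuous_on bounded_linear_cplx)
  have [measurable]: "(\<lambda>x::real^2. x $ i) \<in> borel_measurable borel" for i
    by (intro borel_measurable_continuous_onI continuous_intros)
  have [measurable]: "(\<lambda>x. sgn (cplx x)) \<in> borel_measurable borel"
    unfolding sgn_div_norm by measurable
  show "vortex f n \<in> borel_measurable borel" unfolding vortex_def by measurable
  have "(\<lambda>x. vortex_grad f f' n x \<bullet> b) \<in> borel_measurable borel" if "b \<in> Basis" for b
  proof -
    from that obtain i c where b: "b = axis i c" by (auto simp: Basis_vec_def)
    have "(\<lambda>x. vortex_grad f f' n x $ i) \<in> borel_measurable borel"
    proof -
      have "i = 1 \<or> i = 2" using exhaust_2 by blast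
      then show ?thesis
        unfolding vortex_grad_def Complex_eq by (elim disjE) (simp_all, measurable)
    qed
    then show ?thesis unfolding b inner_axis by measurable
  qed
  then show "vortex_grad f f' n \<in> borel_measurable borel"
    by (subst borel_measurable_euclidean_space) auto
qed

section \<open>Sobolev regularity of vortices\<close>

lemma finite_measure_unit_disc: "finite_measure (lebesgue_on unit_disc)"
  by (rule finite_measure_lebesgue_on) (simp add: lmeasurable_ball)

lemma integrable_unit_disc_bounded:
  fixes g :: "real^2 \<Rightarrow> 'b :: {banach, second_countable_topology}"
  assumes "g \<in> borel_measurable (lebesgue_on unit_disc)" "\<And>x. norm x < 1 \<Longrightarrow> norm (g x) \<le> B"
  shows "integrable (lebesgue_on unit_disc) g"
  using assms by (intro finite_measure.integrable_const_bound[OF finite_measure_unit_disc, of _ B] AE_I2) auto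

text \<open>The hole r^2 <= a in the support keeps the centrifugal term n^2 f^2 / r^2 below n^2 B^2
  / a, so function and gradient are bounded on the disc.\<close>

lemma vortex_H1:
  assumes f: "\<And>u. (f has_real_derivative f' u) (at u)"
    and a: "a > 0" "\<And>u. u \<le> a \<Longrightarrow> f u = 0" "\<And>u. u \<le> a \<Longrightarrow> f' u = 0"
    and [measurable]: "f \<in> borel_measurable borel" "f' \<in> borel_measurable borel"
    and bd: "\<And>u. u \<le> 1 \<Longrightarrow> \<bar>f u\<bar> \<le> B" "\<And>u. u \<le> 1 \<Longrightarrow> \<bar>f' u\<bar> \<le> B"
  shows "H1_on unit_disc (vortex f n) (vortex_grad f f' n)"
proof -
  have B: "B \<ge> 0" using bd(1)[of 0] by simp
  have z: "f 0 = 0" "f' 0 = 0" using a by auto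
  have u: "(norm x)\<^sup>2 \<le> 1" if "norm x < 1" for x :: "real^2"
    using that by (simp add: power_le_one)
  define C where "C = 4 * B\<^sup>2 + (real n)\<^sup>2 * B\<^sup>2 / a"
  have b1: "(norm (vortex f n x))\<^sup>2 \<le> B\<^sup>2" if "norm x < 1" for x
    unfolding norm_vortex[of f, OF z(1)] using power_mono[OF bd(1)[OF u[OF that]] abs_ge_zero, of 2] by simp
  have b2: "(norm (vortex_grad f f' n x))\<^sup>2 \<le> C" if "norm x < 1" for x
  proof -
    let ?u = "(norm x)\<^sup>2"
    have f2: "(f ?u)\<^sup>2 \<le> B\<^sup>2" "(f' ?u)\<^sup>2 \<le> B\<^sup>2"
      using power_mono[OF bd(1)[OF u[OF that]] abs_ge_zero, of 2]
        power_mono[OF bd(2)[OF u[OF that]] abs_ge_zero, of 2] by simp_all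
    have "?u * (f' ?u)\<^sup>2 \<le> 1 * B\<^sup>2" using f2 u[OF that] by (intro mult_mono) auto
    moreover have "(real n)\<^sup>2 * (f ?u)\<^sup>2 / ?u \<le> (real n)\<^sup>2 * B\<^sup>2 / a"
    proof (cases "?u \<le> a")
      case True then show ?thesis using a by simp
    next
      case False then show ?thesis using a(1) f2 by (intro frac_le mult_left_mono) auto
    qed
    ultimately show ?thesis unfolding norm_vortex_grad[of f f', OF z] C_def by simp
  qed
  \<comment> \<open>The weak gradient lemma takes one bound for function and gradient together;
    \<open>B + sqrt C\<close> serves for both.\<close>
  have b1': "norm (vortex f n x) \<le> B + sqrt C" if "norm x < 1" for x
    using power2_le_imp_le[OF b1[OF that] B] a B
    by (simp add: C_def add_increasing2)
  have b2': "norm (vortex_grad f f' n x) \<le> B + sqrt C" if "norm x < 1" for x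
    using real_le_rsqrt[OF b2[OF that]] B by linarith
  note [measurable] = vortex_measurable[of f f' n]
  have weak: "has_weak_gradient_on unit_disc (vortex f n) (vortex_grad f f' n)"
  proof (rule weak_gradient_of_bounded_derivative)
    show "(vortex f n has_derivative (\<lambda>h. \<Sum>i\<in>UNIV. h $ i *\<^sub>R vortex_grad f f' n x $ i)) (at x)" for x
      by (rule vortex_has_derivative[OF f a])
  qed (use b1' b2' in auto)
  have "L2_on unit_disc (vortex f n)" "L2_on unit_disc (vortex_grad f f' n)"
    unfolding L2_on_def using b1 b2
    by (auto intro!: borel_measurable_lebesgue_onI integrable_unit_disc_bounded)
  with weak show ?thesis by (simp add: H1_on_def)
qed

section \<open>The regularised profile\<close>

text \<open>Squaring removes the kink of the positive part: at 0 the difference quotient is at most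
  |h| in modulus.\<close>

lemma has_real_derivative_max_0_square:
  "((\<lambda>p. (max 0 p)\<^sup>2) has_real_derivative 2 * max 0 p) (at p)"
proof -
  consider "p < 0" | "p = 0" | "p > 0" by linarith
  then show ?thesis
  proof cases
    case 1
    have "((\<lambda>p. (max 0 p)\<^sup>2) has_real_derivative 0) (at p)"
      by (rule DERIV_cong_ev[THEN iffD2, OF refl _ refl, of _ "\<lambda>_. 0"])
        (use 1 eventually_nhds_in_open[of "{..<0}" p] in \<open>auto elim!: eventually_mono\<close>)
    with 1 show ?thesis by simp
  next
    case 2
    have "((\<lambda>h. (max 0 h)\<^sup>2 / h) \<longlongrightarrow> 0) (at (0::real))"
    proof (rule Lim_null_comparison)
      have "norm ((max 0 h)\<^sup>2 / h) \<le> \<bar>h\<bar>" for h :: real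
        by (cases "h \<ge> 0") (auto simp: max_def power2_eq_square)
      then show "\<forall>\<^sub>F h in at 0. norm ((max 0 h)\<^sup>2 / h) \<le> \<bar>h\<bar>"
        by simp
      show "((\<lambda>h::real. \<bar>h\<bar>) \<longlongrightarrow> 0) (at 0)" by (intro tendsto_rabs_zero tendsto_ident_at)
    qed
    with 2 show ?thesis by (simp add: DERIV_def)
  next
    case 3
    have "((\<lambda>p. (max 0 p)\<^sup>2) has_real_derivative 2 * p) (at p)"
      by (rule DERIV_cong_ev[THEN iffD2, OF refl _ refl, of _ "\<lambda>p. p\<^sup>2"])
        (use 3 eventually_nhds_in_open[of "{0<..}" p] in \<open>auto elim!: eventually_mono intro!: derivative_eq_intros\<close>)
    with 3 show ?thesis by simp
  qed
qed

text \<open>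
  The Thomas-Fermi density is linear at the inner edge \<open>p = 0\<close> of its support, and the gradient of
  \<open>\<surd>p\<close> is not square integrable there. The square of the profile is \<open>p\<^sup>4 / (p + d)\<^sup>3\<close>, which stays
  within \<open>3d\<close> of \<open>p\<close> and makes the gradient energy logarithmic in \<open>d\<close>.
\<close>

definition profile :: "real \<Rightarrow> real \<Rightarrow> real" where
  "profile d p = (max 0 p)\<^sup>2 * (p + d) powr (-3/2)"

definition profile_deriv :: "real \<Rightarrow> real \<Rightarrow> real" where
  "profile_deriv d p = max 0 p * (p + d) powr (-5/2) * (p / 2 + 2 * d)"

lemma profile_nonpos [simp]: "p \<le> 0 \<Longrightarrow> profile d p = 0" "p \<le> 0 \<Longrightarrow> profile_deriv d p = 0"
  by (simp_all add: profile_def profile_deriv_def)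

lemma profile_measurable [measurable]:
  "profile d \<in> borel_measurable borel" "profile_deriv d \<in> borel_measurable borel"
  unfolding profile_def[abs_def] profile_deriv_def[abs_def] by measurable

text \<open>For p >= 0 the two product rule terms combine through 2 p (p + d) - 3/2 p^2 = p (p/2 + 2
  d).\<close>

lemma profile_has_real_derivative:
  assumes "d > 0"
  shows "(profile d has_real_derivative profile_deriv d p) (at p)"
proof (cases "p < 0")
  case True
  have "(profile d has_real_derivative 0) (at p)"
    by (rule DERIV_cong_ev[THEN iffD2, OF refl _ refl, of _ "\<lambda>_. 0"])
      (use True eventually_nhds_in_open[of "{..<0}" p] in \<open>auto elim!: eventually_mono\<close>)
  with True show ?thesis by simp
next
  case False
  then have pos: "p + d > 0" using assms by simp
  have "((\<lambda>p. (p + d) powr (-3/2)) has_real_derivative (-3/2) * (p + d) powr (-3/2 - 1)) (at p)"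
    using pos by (auto intro!: derivative_eq_intros)
  then have "(profile d has_real_derivative
      2 * max 0 p * (p + d) powr (-3/2) + (-3/2) * (p + d) powr (-3/2 - 1) * (max 0 p)\<^sup>2) (at p)"
    unfolding profile_def[abs_def] by (rule DERIV_mult[OF has_real_derivative_max_0_square])
  moreover have "(p + d) powr (-3/2) = (p + d) powr (-5/2) * (p + d)"
    using pos powr_add[of "p + d" "-5/2" 1] by simp
  ultimately show ?thesis
    using False by (simp add: profile_deriv_def power2_eq_square algebra_simps)
qed

lemma profile_square:
  assumes "d > 0" "p > 0"
  shows "(profile d p)\<^sup>2 = p ^ 4 / (p + d) ^ 3"
proof -
  have "((p + d) powr (-3/2))\<^sup>2 = (p + d) powr (-3)"
    using assms by (simp add: powr_power)
  also have "\<dots> = 1 / (p + d) ^ 3"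
    using assms by (simp add: powr_minus powr_realpow[of _ 3, simplified] divide_inverse)
  finally show ?thesis
    using assms by (simp add: profile_def power_mult_distrib flip: power_mult)
qed

text \<open>The second bound is (1 + d/p)^(-3) >= 1 - 3 d/p multiplied by p. The error is switched
  off for p <= 0, so that integrating it yields only the area of the annulus.\<close>

lemma profile_square_close:
  assumes "d > 0"
  shows "(profile d p)\<^sup>2 \<le> max 0 p" "max 0 p - (if p > 0 then 3 * d else 0) \<le> (profile d p)\<^sup>2"
proof -
  have "p ^ 4 \<le> p * (p + d) ^ 3" if "p > 0"
  proof -
    have "p ^ 3 \<le> (p + d) ^ 3" using that assms by (intro power_mono) auto
    then have "p * p ^ 3 \<le> p * (p + d) ^ 3" using that by (intro mult_left_mono) auto
    then show ?thesis by (simp add: eval_nat_numeral)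
  qed
  then show "(profile d p)\<^sup>2 \<le> max 0 p"
    using assms by (cases "p > 0") (auto simp: profile_square divide_le_eq)
  have "(p - 3 * d) * (p + d) ^ 3 \<le> p ^ 4" if "p > 0"
  proof -
    \<comment> \<open>The constant 3 makes the terms of first order in \<open>d\<close>
      cancel.\<close>
    have "p ^ 4 - (p - 3 * d) * (p + d) ^ 3 = 6 * p\<^sup>2 * d\<^sup>2 + 8 * p * d ^ 3 + 3 * d ^ 4"
      by (simp add: eval_nat_numeral algebra_simps)
    also have "\<dots> \<ge> 0" using that assms by simp
    finally show ?thesis by simp
  qed
  then show "max 0 p - (if p > 0 then 3 * d else 0) \<le> (profile d p)\<^sup>2"
    using assms by (cases "p > 0") (auto simp: profile_square le_divide_eq)
qed

text \<open>Both p <= p + d and p/2 + 2 d <= 2 (p + d) are used. The singularity 1/p of the squared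
  gradient of sqrt p is cut off at \<open>d\<close>, so the integral is logarithmic.\<close>

lemma profile_deriv_square_le:
  assumes "d > 0"
  shows "(profile_deriv d p)\<^sup>2 \<le> (if p > 0 then 4 / (p + d) else 0)"
proof (cases "p > 0")
  case True
  then have pd: "p + d > 0" using assms by simp
  have "((p + d) powr (-5/2))\<^sup>2 = (p + d) powr (-5)"
    using pd by (simp add: powr_power)
  also have "\<dots> = 1 / (p + d) ^ 5"
    using pd by (simp add: powr_minus powr_realpow[of _ 5, simplified] divide_inverse)
  finally have eq: "(profile_deriv d p)\<^sup>2 = p\<^sup>2 * (p / 2 + 2 * d)\<^sup>2 / (p + d) ^ 5"
    using True by (simp add: profile_deriv_def power_mult_distrib)
  have "p\<^sup>2 * (p / 2 + 2 * d)\<^sup>2 \<le> (p + d)\<^sup>2 * (2 * (p + d))\<^sup>2"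
    using True assms by (intro mult_mono power_mono) auto
  also have "\<dots> = 4 / (p + d) * (p + d) ^ 5"
    using pd by (simp add: eval_nat_numeral field_simps)
  finally show ?thesis
    unfolding eq using True pd by (simp add: divide_le_eq)
qed simp

text \<open>In the variable u = r^2 an outer annulus becomes \<open>{a..1}\<close> with constant
  weight pi, up to the null set of endpoints.\<close>

lemma lebesgue_integral_radial_FTC:
  fixes g G :: "real \<Rightarrow> real"
  assumes a: "0 \<le> a" "a \<le> 1"
    and [measurable]: "g \<in> borel_measurable borel"
    and der: "\<And>u. a \<le> u \<Longrightarrow> u \<le> 1 \<Longrightarrow> (G has_real_derivative g u) (at u)"
    and cont: "\<And>u. a \<le> u \<Longrightarrow> u \<le> 1 \<Longrightarrow> isCont g u"
  shows "(LINT x|lebesgue_on unit_disc. (if (norm x)\<^sup>2 > a then g ((norm x)\<^sup>2) else 0)) = pi * (G 1 - G a)"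
proof -
  have "(LINT x|lebesgue_on unit_disc. (if (norm x)\<^sup>2 > a then g ((norm x)\<^sup>2) else 0)) =
      pi * (LBINT u:{0<..<1}. (if u > a then g u else 0))"
    by (rule lebesgue_integral_radial[of "\<lambda>u. if u > a then g u else 0"]) measurable
  also have "(LBINT u:{0<..<1}. (if u > a then g u else 0)) = (LBINT u. g u * indicator {a..1} u)"
    unfolding set_lebesgue_integral_def
  proof (rule integral_cong_AE)
    show "AE u in lborel. indicat_real {0<..<1} u *\<^sub>R (if a < u then g u else 0) = g u * indicat_real {a..1} u"
      using AE_lborel_singleton[of a] AE_lborel_singleton[of 1]
      by eventually_elim (use a in \<open>auto simp: indicator_def\<close>)
  qed measurable
  also have "\<dots> = G 1 - G a"
    by (rule integral_FTC_Icc_real) (use a der cont in auto)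
  finally show ?thesis .
qed

section \<open>Lower bounds\<close>

text \<open>Weak duality with \<open>a\<close> as Lagrange multiplier: \<rho>^2 >= 2 q \<rho> - q^2,
  and q is at least the untruncated linear function while \<rho> >= 0. Integrating with total mass
  one gives the bound without a minimiser.\<close>

lemma TF_functional_lower_bound:
  assumes s: "s = \<epsilon> powr (2 * \<alpha>)" "\<epsilon> > 0"
    and \<rho>: "L2_on unit_disc \<rho>" "AE x in lebesgue_on unit_disc. 0 \<le> \<rho> x"
      "(LINT x|lebesgue_on unit_disc. \<rho> x) = 1"
    and q: "\<And>u. q u = \<Omega>\<^sub>1\<^sup>2 / (8 * s) * max 0 (u - a)"
  shows "- \<Omega>\<^sub>1\<^sup>2 * a / 4 - s * (LINT x|lebesgue_on unit_disc. (q ((norm x)\<^sup>2))\<^sup>2)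
           \<le> TF_functional \<Omega>\<^sub>1 \<alpha> \<epsilon> \<rho>"
proof -
  let ?D = "lebesgue_on unit_disc"
  define K where "K = \<Omega>\<^sub>1\<^sup>2 / (8 * s)"
  have s0: "s > 0" using s by simp
  have K0: "K \<ge> 0" using s0 by (simp add: K_def)
  have [measurable]: "q \<in> borel_measurable borel" unfolding q[abs_def] by measurable
  \<comment> \<open>A non-integrable density would have the default integral 0, not 1.\<close>
  have i1[simp]: "integrable ?D \<rho>" using \<rho>(3) not_integrable_integral_eq by force
  have i2[simp]: "integrable ?D (\<lambda>x. (\<rho> x)\<^sup>2)" using \<rho>(1) by (simp add: L2_on_def)
  have [measurable]: "\<rho> \<in> borel_measurable ?D" using \<rho>(1) by (simp add: L2_on_def)
  have [measurable]: "(\<lambda>x. (norm x)\<^sup>2) \<in> borel_measurable ?D"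
    by (intro borel_measurable_lebesgue_onI) measurable
  have i3[simp]: "integrable ?D (\<lambda>x. (norm x)\<^sup>2 * \<rho> x)"
  proof (rule Bochner_Integration.integrable_bound[OF i1])
    show "AE x in ?D. norm ((norm x)\<^sup>2 * \<rho> x) \<le> norm (\<rho> x)"
      by (rule AE_I2) (auto simp: abs_mult power_le_one intro!: mult_left_le_one_le)
  qed measurable
  have i4[simp]: "integrable ?D (\<lambda>x. (q ((norm x)\<^sup>2))\<^sup>2)"
  proof (rule integrable_unit_disc_bounded[where B="(K * (1 + \<bar>a\<bar>))\<^sup>2"])
    show "norm ((q ((norm x)\<^sup>2))\<^sup>2) \<le> (K * (1 + \<bar>a\<bar>))\<^sup>2" if "norm x < 1" for x :: "real^2"
    proof -
      have "max 0 ((norm x)\<^sup>2 - a) \<le> 1 + \<bar>a\<bar>" using that power_le_one[of "norm x" 2] by auto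
      then have "\<bar>q ((norm x)\<^sup>2)\<bar> \<le> K * (1 + \<bar>a\<bar>)"
        using K0 unfolding q K_def[symmetric] by (auto simp: abs_mult intro!: mult_left_mono)
      then show ?thesis using power_mono[of "\<bar>q ((norm x)\<^sup>2)\<bar>" _ 2] by simp
    qed
  qed (intro borel_measurable_lebesgue_onI, measurable)
  have "(LINT x|?D. - 2 * K * a * \<rho> x - (q ((norm x)\<^sup>2))\<^sup>2) \<le>
     (LINT x|?D. (\<rho> x)\<^sup>2 - 2 * K * ((norm x)\<^sup>2 * \<rho> x))"
  proof (rule integral_mono_AE)
    show "AE x in ?D. - 2 * K * a * \<rho> x - (q ((norm x)\<^sup>2))\<^sup>2 \<le> (\<rho> x)\<^sup>2 - 2 * K * ((norm x)\<^sup>2 * \<rho> x)"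
      using \<rho>(2)
    proof eventually_elim
      case (elim x)
      let ?u = "(norm x)\<^sup>2"
      have "2 * (K * (?u - a)) * \<rho> x \<le> 2 * q ?u * \<rho> x"
        using elim K0 unfolding q K_def[symmetric] by (intro mult_right_mono mult_left_mono) auto
      moreover have "0 \<le> (\<rho> x - q ?u)\<^sup>2" by simp
      ultimately show ?case by (simp add: power2_eq_square algebra_simps)
    qed
  qed simp_all
  also have "(LINT x|?D. - 2 * K * a * \<rho> x - (q ((norm x)\<^sup>2))\<^sup>2) = - 2 * K * a - (LINT x|?D. (q ((norm x)\<^sup>2))\<^sup>2)"
    using \<rho>(3) by simp
  also have "(LINT x|?D. (\<rho> x)\<^sup>2 - 2 * K * ((norm x)\<^sup>2 * \<rho> x)) =
     (LINT x|?D. (\<rho> x)\<^sup>2 - \<Omega>\<^sub>1\<^sup>2 * (norm x)\<^sup>2 * \<rho> x / (4 * s))"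
    by (simp add: K_def mult_ac)
  finally have "s * (- 2 * K * a - (LINT x|?D. (q ((norm x)\<^sup>2))\<^sup>2)) \<le> TF_functional \<Omega>\<^sub>1 \<alpha> \<epsilon> \<rho>"
    using s0 unfolding TF_functional_def s(1)[symmetric] by (intro mult_left_mono) auto
  then show ?thesis using s0 by (simp add: K_def algebra_simps)
qed

section \<open>Comparison of the GP functional with the TF functional\<close>

lemma norm_ang_mom_le: "cmod (ang_mom x g) \<le> 2 * norm x * norm g"
proof -
  have "cmod (ang_mom x g) \<le> \<bar>x $ 1\<bar> * cmod (g $ 2) + \<bar>x $ 2\<bar> * cmod (g $ 1)"
    unfolding ang_mom_def norm_mult
    by (rule order_trans, rule mult_left_mono[OF norm_triangle_ineq4]) (auto simp: norm_mult)
  also have "\<dots> \<le> norm x * norm g + norm x * norm g"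
    by (intro add_mono mult_mono component_le_norm_cart Finite_Cartesian_Product.norm_nth_le) auto
  finally show ?thesis by simp
qed

text \<open>The left-hand side is \<open>\<bar>\<nabla>\<Psi> - iA\<Psi>\<bar>\<^sup>2\<close> for the vector potential \<open>A = \<Omega>/2 (-x\<^sub>2, x\<^sub>1)\<close>.\<close>

lemma magnetic_square:
  "(norm (vector [g $ 1 + \<i> * of_real (\<Omega> / 2 * x $ 2) * \<psi>, g $ 2 - \<i> * of_real (\<Omega> / 2 * x $ 1) * \<psi>] :: complex^2))\<^sup>2 =
     (norm g)\<^sup>2 - \<Omega> * Re (cnj \<psi> * ang_mom x g) + \<Omega>\<^sup>2 * (norm x)\<^sup>2 / 4 * (cmod \<psi>)\<^sup>2"
proof -
  have vec: "(norm (vector [v, w] :: complex^2))\<^sup>2 = (cmod v)\<^sup>2 + (cmod w)\<^sup>2" for v w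
    by (simp add: norm_vec_def L2_set_def sum_2)
  have g: "(norm g)\<^sup>2 = (cmod (g $ 1))\<^sup>2 + (cmod (g $ 2))\<^sup>2"
    by (simp add: norm_vec_def L2_set_def sum_2)
  show ?thesis
    unfolding vec g norm_square_2[of x] cmod_power2 ang_mom_def
    by (simp add: power2_eq_square) (simp add: field_simps)
qed

text \<open>Dropping the nonnegative magnetic kinetic energy leaves only the centrifugal
  term.\<close>

lemma GP_integrand_ge:
  "- \<Omega>\<^sup>2 * (norm x)\<^sup>2 / 4 * (cmod \<psi>)\<^sup>2 \<le> (norm g)\<^sup>2 - \<Omega> * Re (cnj \<psi> * ang_mom x g)"
  using zero_le_power2[of "norm (vector [g $ 1 + \<i> * of_real (\<Omega> / 2 * x $ 2) * \<psi>, g $ 2 - \<i> * of_real (\<Omega> / 2 * x $ 1) * \<psi>] :: complex^2)"]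
  unfolding magnetic_square by simp

text \<open>On the disc the product is at most 2 |\<Psi>| |G|, hence dominated by the sum of the
  squares.\<close>

lemma ang_mom_integrable:
  assumes "H1_on unit_disc \<Psi> G"
  shows "integrable (lebesgue_on unit_disc) (\<lambda>x. cnj (\<Psi> x) * ang_mom x (G x))"
proof -
  let ?D = "lebesgue_on unit_disc"
  have [measurable]: "\<Psi> \<in> borel_measurable ?D" "G \<in> borel_measurable ?D"
    and i: "integrable ?D (\<lambda>x. (norm (\<Psi> x))\<^sup>2)" "integrable ?D (\<lambda>x. (norm (G x))\<^sup>2)"
    using assms by (auto simp: H1_on_def L2_on_def)
  have [measurable]: "(\<lambda>x. x $ j) \<in> borel_measurable ?D" for j
    by (intro borel_measurable_lebesgue_onI borel_measurable_continuous_onI continuous_intros)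
  have [measurable]: "(\<lambda>x. G x $ j) \<in> borel_measurable ?D" for j
    by (rule measurable_compose[OF _ borel_measurable_continuous_onI[of "\<lambda>v. v $ j"]])
      (auto intro!: continuous_intros)
  have [measurable]: "(\<lambda>x. cnj (\<Psi> x)) \<in> borel_measurable ?D"
    by (rule measurable_compose[OF _ borel_measurable_continuous_onI[of cnj]])
      (auto intro!: continuous_intros)
  show ?thesis
  proof (rule Bochner_Integration.integrable_bound[OF Bochner_Integration.integrable_add[OF i]])
    show "AE x in ?D. norm (cnj (\<Psi> x) * ang_mom x (G x)) \<le> norm ((norm (\<Psi> x))\<^sup>2 + (norm (G x))\<^sup>2)"
    proof (rule AE_I2)
      fix x assume "x \<in> space ?D"
      then have x: "norm x \<le> 1" by simp
      have "norm (cnj (\<Psi> x) * ang_mom x (G x)) \<le> norm (\<Psi> x) * (2 * norm x * norm (G x))"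
        unfolding norm_mult complex_mod_cnj by (intro mult_left_mono norm_ang_mom_le) auto
      also have "\<dots> \<le> norm (\<Psi> x) * (2 * 1 * norm (G x))"
        using x by (intro mult_left_mono mult_right_mono) auto
      also have "\<dots> \<le> (norm (\<Psi> x))\<^sup>2 + (norm (G x))\<^sup>2"
        using zero_le_power2[of "norm (\<Psi> x) - norm (G x)"] by (simp add: power2_eq_square algebra_simps)
      finally show "norm (cnj (\<Psi> x) * ang_mom x (G x)) \<le> norm ((norm (\<Psi> x))\<^sup>2 + (norm (G x))\<^sup>2)"
        by simp
    qed
  qed (unfold ang_mom_def, measurable)
qed

lemma L2_norm_on_eq_1_iff:
  "L2_norm_on S f = 1 \<longleftrightarrow> (LINT x|lebesgue_on S. (norm (f x))\<^sup>2) = 1"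
  by (simp add: L2_norm_on_def)

text \<open>The alternative covers the junk value of the Bochner integral.\<close>

lemma GP_functional_ge_TF_functional:
  fixes \<Omega>\<^sub>1 \<alpha> \<epsilon> :: real
  assumes \<epsilon>: "\<epsilon> > 0" and H: "H1_on unit_disc \<Psi> G" and nrm: "L2_norm_on unit_disc \<Psi> = 1"
  defines "\<Omega> \<equiv> \<Omega>\<^sub>1 / \<epsilon> powr (1 + \<alpha>)"
  shows "GP_functional \<Omega> \<epsilon> \<Psi> G = 0 \<or>
    (L2_on unit_disc (\<lambda>x. (cmod (\<Psi> x))\<^sup>2) \<and>
     TF_functional \<Omega>\<^sub>1 \<alpha> \<epsilon> (\<lambda>x. (cmod (\<Psi> x))\<^sup>2) \<le> \<epsilon> powr (2 + 2 * \<alpha>) * GP_functional \<Omega> \<epsilon> \<Psi> G)"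
proof -
  let ?D = "lebesgue_on unit_disc"
  define I where "I = (\<lambda>x. complex_of_real ((norm (G x))\<^sup>2)
           - complex_of_real \<Omega> * (cnj (\<Psi> x) * ang_mom x (G x))
           + complex_of_real (cmod (\<Psi> x) ^ 4 / \<epsilon>\<^sup>2))"
  have GP: "GP_functional \<Omega> \<epsilon> \<Psi> G = Re (LINT x|?D. I x)"
    by (simp add: GP_functional_def I_def)
  show ?thesis
  proof (cases "integrable ?D I")
    case False
    then show ?thesis by (simp add: GP not_integrable_integral_eq)
  next
    case True
    have [measurable]: "\<Psi> \<in> borel_measurable ?D"
      and i1: "integrable ?D (\<lambda>x. (norm (\<Psi> x))\<^sup>2)" and i2: "integrable ?D (\<lambda>x. (norm (G x))\<^sup>2)"
      using H by (auto simp: H1_on_def L2_on_def)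
    have [measurable]: "(\<lambda>x. (norm x)\<^sup>2) \<in> borel_measurable ?D"
      by (intro borel_measurable_lebesgue_onI) measurable
    \<comment> \<open>Removing the kinetic and rotation terms from the integrable total shows that
      the quartic term is integrable, without a Sobolev embedding.\<close>
    have "integrable ?D (\<lambda>x. I x - complex_of_real ((norm (G x))\<^sup>2)
           + complex_of_real \<Omega> * (cnj (\<Psi> x) * ang_mom x (G x)))"
      using True i2 ang_mom_integrable[OF H]
      by (intro Bochner_Integration.integrable_add Bochner_Integration.integrable_diff
          integrable_mult_right integrable_of_real) auto
    then have "integrable ?D (\<lambda>x. complex_of_real (cmod (\<Psi> x) ^ 4 / \<epsilon>\<^sup>2))"
      by (simp add: I_def)
    then have "integrable ?D (\<lambda>x. \<epsilon>\<^sup>2 * Re (complex_of_real (cmod (\<Psi> x) ^ 4 / \<epsilon>\<^sup>2)))"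
      by (intro integrable_mult_right integrable_Re)
    then have i4: "integrable ?D (\<lambda>x. ((cmod (\<Psi> x))\<^sup>2)\<^sup>2)"
      using \<epsilon> by (simp flip: power_mult)
    have i3: "integrable ?D (\<lambda>x. (norm x)\<^sup>2 * (cmod (\<Psi> x))\<^sup>2)"
    proof (rule Bochner_Integration.integrable_bound[OF i1])
      show "AE x in ?D. norm ((norm x)\<^sup>2 * (cmod (\<Psi> x))\<^sup>2) \<le> norm ((cmod (\<Psi> x))\<^sup>2)"
        by (rule AE_I2) (auto simp: abs_mult power_le_one intro!: mult_left_le_one_le)
    qed measurable
    have sc: "\<epsilon> powr (2 + 2 * \<alpha>) * (\<Omega>\<^sup>2) = \<Omega>\<^sub>1\<^sup>2" 
      using \<epsilon> by (simp add: \<Omega>_def power_divide powr_power algebra_simps)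
    have e2: "\<epsilon> powr (2 + 2 * \<alpha>) = \<epsilon>\<^sup>2 * \<epsilon> powr (2 * \<alpha>)"
      using \<epsilon> by (simp add: powr_add powr_numeral)
    have "TF_functional \<Omega>\<^sub>1 \<alpha> \<epsilon> (\<lambda>x. (cmod (\<Psi> x))\<^sup>2) =
       (LINT x|?D. \<epsilon> powr (2 * \<alpha>) * (((cmod (\<Psi> x))\<^sup>2)\<^sup>2 - \<Omega>\<^sub>1\<^sup>2 * (norm x)\<^sup>2 * (cmod (\<Psi> x))\<^sup>2 / (4 * \<epsilon> powr (2 * \<alpha>))))"
      by (simp add: TF_functional_def)
    also have "\<dots> = (LINT x|?D. \<epsilon> powr (2 + 2 * \<alpha>) * (((cmod (\<Psi> x))\<^sup>2)\<^sup>2 / \<epsilon>\<^sup>2 - \<Omega>\<^sup>2 / 4 * ((norm x)\<^sup>2 * (cmod (\<Psi> x))\<^sup>2)))"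
    proof (intro Bochner_Integration.integral_cong refl)
      fix x
      show "\<epsilon> powr (2 * \<alpha>) * (((cmod (\<Psi> x))\<^sup>2)\<^sup>2 - \<Omega>\<^sub>1\<^sup>2 * (norm x)\<^sup>2 * (cmod (\<Psi> x))\<^sup>2 / (4 * \<epsilon> powr (2 * \<alpha>))) =
        \<epsilon> powr (2 + 2 * \<alpha>) * (((cmod (\<Psi> x))\<^sup>2)\<^sup>2 / \<epsilon>\<^sup>2 - \<Omega>\<^sup>2 / 4 * ((norm x)\<^sup>2 * (cmod (\<Psi> x))\<^sup>2))"
        unfolding e2 sc[unfolded e2, symmetric] using \<epsilon> by (simp add: field_simps)
    qed
    also have "\<dots> = \<epsilon> powr (2 + 2 * \<alpha>) * (LINT x|?D. ((cmod (\<Psi> x))\<^sup>2)\<^sup>2 / \<epsilon>\<^sup>2 - \<Omega>\<^sup>2 / 4 * ((norm x)\<^sup>2 * (cmod (\<Psi> x))\<^sup>2))"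
      by simp
    also have "\<dots> \<le> \<epsilon> powr (2 + 2 * \<alpha>) * (LINT x|?D. Re (I x))"
    proof (intro mult_left_mono integral_mono)
      show "((cmod (\<Psi> x))\<^sup>2)\<^sup>2 / \<epsilon>\<^sup>2 - \<Omega>\<^sup>2 / 4 * ((norm x)\<^sup>2 * (cmod (\<Psi> x))\<^sup>2) \<le> Re (I x)" for x
      proof -
        have "Re (I x) = (norm (G x))\<^sup>2 - \<Omega> * Re (cnj (\<Psi> x) * ang_mom x (G x)) + ((cmod (\<Psi> x))\<^sup>2)\<^sup>2 / \<epsilon>\<^sup>2"
          unfolding I_def by (simp flip: power_mult)
        then show ?thesis using GP_integrand_ge[of \<Omega> x "\<Psi> x" "G x"] by (simp add: algebra_simps)
      qed
    qed (use i3 i4 True in \<open>auto intro!: integrable_Re\<close>)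
    also have "(LINT x|?D. Re (I x)) = GP_functional \<Omega> \<epsilon> \<Psi> G"
      using True by (simp add: GP)
    finally show ?thesis using i4 by (simp add: L2_on_def)
  qed
qed

section \<open>Energy of the trial function\<close>

text \<open>A single small \<epsilon> is fixed. \<open>thin\<close> keeps the annulus inside r^2 >=
  1/2; the bound 1/12 ensures that regularisation loses at most half of the mass and that |ln
  \<epsilon>| >= 1.\<close>

locale TF_regime =
  fixes \<Omega>\<^sub>1 \<alpha> \<epsilon> :: real
  assumes \<Omega>\<^sub>1_pos: "\<Omega>\<^sub>1 > 0"
    and \<epsilon>_pos: "\<epsilon> > 0"
    and \<epsilon>_le: "\<epsilon> \<le> 1 / 12"
    and thin: "4 * \<epsilon> powr \<alpha> / (sqrt pi * \<Omega>\<^sub>1) \<le> 1 / 2"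
begin

abbreviation "D \<equiv> lebesgue_on unit_disc"

definition "s = \<epsilon> powr (2 * \<alpha>)"
definition "\<Omega> = \<Omega>\<^sub>1 / \<epsilon> powr (1 + \<alpha>)"

text \<open>The Thomas-Fermi density lives on the annulus \<open>a < \<bar>x\<bar>\<^sup>2 < 1\<close> of area \<open>\<pi> \<l>\<close>; radial functions
  are written as functions of \<open>u = \<bar>x\<bar>\<^sup>2\<close>.\<close>

definition "\<l> = 4 * \<epsilon> powr \<alpha> / (sqrt pi * \<Omega>\<^sub>1)"
definition "a = 1 - \<l>"
definition "d = \<epsilon> * \<l>"
definition "q u = \<Omega>\<^sub>1\<^sup>2 / (8 * s) * max 0 (u - a)"
text \<open>The TF energy of \<open>q\<close> in dual form, with multiplier \<open>a\<close>. It
  enters only as a common reference value for the TF and GP energies.\<close>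

definition "E\<^sub>0 = - \<Omega>\<^sub>1\<^sup>2 * a / 4 - s * (LINT x|D. (q ((norm x)\<^sup>2))\<^sup>2)"
definition "J = (LINT x|D. (profile d ((norm x)\<^sup>2 - a))\<^sup>2)"
definition "f u = profile d (u - a) / sqrt J"
definition "f' u = profile_deriv d (u - a) / sqrt J"
text \<open>Near the boundary (n/r - \<Omega> r/2)^2 is smallest for n close to \<Omega>/2; rounding
  costs less than 1.\<close>

definition "n = nat \<lfloor>\<Omega> / 2\<rfloor>"

section \<open>Relations between the scales\<close>

lemma s_pos: "s > 0"
  using \<epsilon>_pos by (simp add: s_def)

lemma l_pos: "\<l> > 0" and l_le: "\<l> \<le> 1 / 2"
  using \<Omega>\<^sub>1_pos \<epsilon>_pos thin by (auto simp: \<l>_def)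

lemma a_bounds: "1 / 2 \<le> a" "a < 1"
  using l_pos l_le by (auto simp: a_def)

lemma d_pos: "d > 0"
  using l_pos \<epsilon>_pos by (simp add: d_def)

text \<open>Makes \<open>\<l>\<close> the only length scale: \<open>s\<close> over
  \<open>\<l>\<^sup>2\<close> is a constant, which later cancels the thickness from the error
  terms.\<close>

lemma s_eq: "s = pi * \<Omega>\<^sub>1\<^sup>2 * \<l>\<^sup>2 / 16"
proof -
  have "\<l>\<^sup>2 = 16 * (\<epsilon> powr \<alpha>)\<^sup>2 / (pi * \<Omega>\<^sub>1\<^sup>2)"
    by (simp add: \<l>_def power_divide power_mult_distrib)
  also have "(\<epsilon> powr \<alpha>)\<^sup>2 = s" using \<epsilon>_pos by (simp add: s_def powr_power mult.commute)
  finally show ?thesis using \<Omega>\<^sub>1_pos by (simp add: field_simps)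
qed

text \<open>Together with \<open>integral_max\<close> this says that \<open>q\<close> has mass one,
  which is the condition that fixes \<open>\<l>\<close>.\<close>

lemma q_eq: "q u = max 0 (u - a) / (pi * \<l>\<^sup>2 / 2)"
  using \<Omega>\<^sub>1_pos l_pos unfolding q_def s_eq by (simp add: field_simps)

lemma scaling: "\<epsilon>\<^sup>2 * s * \<Omega>\<^sup>2 = \<Omega>\<^sub>1\<^sup>2" "\<epsilon> powr (2 + 2 * \<alpha>) = \<epsilon>\<^sup>2 * s" "\<Omega> > 0"
proof -
  show 1: "\<epsilon> powr (2 + 2 * \<alpha>) = \<epsilon>\<^sup>2 * s"
    using \<epsilon>_pos by (simp add: s_def powr_add powr_numeral)
  have "\<epsilon> powr (2 + 2 * \<alpha>) * \<Omega>\<^sup>2 = \<Omega>\<^sub>1\<^sup>2" 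
    using \<epsilon>_pos by (simp add: \<Omega>_def power_divide powr_power algebra_simps)
  then show "\<epsilon>\<^sup>2 * s * \<Omega>\<^sup>2 = \<Omega>\<^sub>1\<^sup>2" unfolding 1 .
  show "\<Omega> > 0" using \<Omega>\<^sub>1_pos \<epsilon>_pos by (simp add: \<Omega>_def)
qed

lemma q_measurable [measurable]: "q \<in> borel_measurable borel"
  and f_measurable [measurable]: "f \<in> borel_measurable borel" "f' \<in> borel_measurable borel"
  unfolding q_def[abs_def] f_def[abs_def] f'_def[abs_def] by measurable

lemma norm_square_measurable [measurable]: "(\<lambda>x. (norm x)\<^sup>2) \<in> borel_measurable D"
  by (intro borel_measurable_lebesgue_onI) measurable

section \<open>Integrals over the annulus and the mass of the profile\<close>

lemma integrable_radial_bounded: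
  assumes [measurable]: "g \<in> borel_measurable borel" 
    and "\<And>u. 0 \<le> u \<Longrightarrow> u \<le> 1 \<Longrightarrow> \<bar>g u\<bar> \<le> B"
  shows "integrable D (\<lambda>x. g ((norm x)\<^sup>2) :: real)"
  by (rule integrable_unit_disc_bounded[where B=B]) (use assms(2) in \<open>auto simp: power_le_one\<close>)

lemma integral_max: "(LINT x|D. max 0 ((norm x)\<^sup>2 - a)) = pi * \<l>\<^sup>2 / 2"
proof -
  have "(LINT x|D. max 0 ((norm x)\<^sup>2 - a)) = (LINT x|D. (if (norm x)\<^sup>2 > a then (norm x)\<^sup>2 - a else 0))"
    by (intro Bochner_Integration.integral_cong) auto
  also have "\<dots> = pi * ((1 - a)\<^sup>2 / 2 - (a - a)\<^sup>2 / 2)"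
    by (rule lebesgue_integral_radial_FTC) (use a_bounds in \<open>auto intro!: derivative_eq_intros\<close>)
  finally show ?thesis by (simp add: a_def)
qed

lemma integral_annulus: "(LINT x|D. (if (norm x)\<^sup>2 > a then 1 else 0)) = pi * \<l>"
  using lebesgue_integral_radial_FTC[of a "\<lambda>_. 1" "\<lambda>u. u"] a_bounds by (simp add: a_def)

text \<open>The source of the logarithm. Because \<open>d\<close> is \<epsilon> times the thickness,
  the result does not depend on \<open>\<l>\<close>.\<close>

lemma integral_inverse: 
  "(LINT x|D. (if (norm x)\<^sup>2 > a then 1 / ((norm x)\<^sup>2 - a + d) else 0)) = pi * ln (1 + 1 / \<epsilon>)"
proof -
  have "(LINT x|D. (if (norm x)\<^sup>2 > a then 1 / ((norm x)\<^sup>2 - a + d) else 0)) =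
      pi * (ln (1 - a + d) - ln (a - a + d))"
    by (rule lebesgue_integral_radial_FTC)
      (use a_bounds d_pos in \<open>auto intro!: derivative_eq_intros continuous_intros\<close>)
  also have "ln (1 - a + d) - ln (a - a + d) = ln ((\<l> + d) / d)"
    using d_pos l_pos by (simp add: ln_div a_def)
  also have "(\<l> + d) / d = 1 + 1 / \<epsilon>"
    using l_pos \<epsilon>_pos by (simp add: d_def field_simps)
  finally show ?thesis .
qed

lemma integrable_basic [simp]:
  "integrable D (\<lambda>x. max 0 ((norm x)\<^sup>2 - a))"
  "integrable D (\<lambda>x. (if (norm x)\<^sup>2 > a then 1 else 0) :: real)"
  "integrable D (\<lambda>x. (if (norm x)\<^sup>2 > a then 1 / ((norm x)\<^sup>2 - a + d) else 0))"
  "integrable D (\<lambda>x. (profile d ((norm x)\<^sup>2 - a))\<^sup>2)"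
  "integrable D (\<lambda>x. (q ((norm x)\<^sup>2))\<^sup>2)"
proof -
  show "integrable D (\<lambda>x. max 0 ((norm x)\<^sup>2 - a))"
    by (rule integrable_radial_bounded[where g="\<lambda>u. max 0 (u - a)" and B=1]) (use a_bounds in auto)
  show "integrable D (\<lambda>x. (if (norm x)\<^sup>2 > a then 1 else 0) :: real)"
    by (rule integrable_radial_bounded[where g="\<lambda>u. if u > a then 1 else 0" and B=1]) auto
  show "integrable D (\<lambda>x. (if (norm x)\<^sup>2 > a then 1 / ((norm x)\<^sup>2 - a + d) else 0))"
    by (rule integrable_radial_bounded[where g="\<lambda>u. if u > a then 1 / (u - a + d) else 0" and B="1 / d"])
      (use d_pos in \<open>auto intro!: divide_left_mono mult_pos_pos\<close>)
  show "integrable D (\<lambda>x. (profile d ((norm x)\<^sup>2 - a))\<^sup>2)"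
  proof (rule integrable_radial_bounded[where g="\<lambda>u. (profile d (u - a))\<^sup>2" and B=1])
    show "\<bar>(profile d (u - a))\<^sup>2\<bar> \<le> 1" if "0 \<le> u" "u \<le> 1" for u
      using profile_square_close(1)[OF d_pos, of "u - a"] that a_bounds by auto
  qed measurable
  show "integrable D (\<lambda>x. (q ((norm x)\<^sup>2))\<^sup>2)"
  proof (rule integrable_radial_bounded[where g="\<lambda>u. (q u)\<^sup>2" and B="(1 / (pi * \<l>\<^sup>2 / 2))\<^sup>2"])
    show "\<bar>(q u)\<^sup>2\<bar> \<le> (1 / (pi * \<l>\<^sup>2 / 2))\<^sup>2" if "0 \<le> u" "u \<le> 1" for u
      unfolding q_eq abs_power2 using that a_bounds by (intro power_mono divide_right_mono) auto
  qed measurable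
qed

lemma J_le: "J \<le> pi * \<l>\<^sup>2 / 2"
  unfolding J_def integral_max[symmetric]
  by (intro integral_mono) (auto intro: profile_square_close(1)[OF d_pos])

lemma J_ge_difference: "pi * \<l>\<^sup>2 / 2 - 3 * d * (pi * \<l>) \<le> J"
proof -
  have "(LINT x|D. max 0 ((norm x)\<^sup>2 - a) - 3 * d * (if (norm x)\<^sup>2 > a then 1 else 0)) \<le> J"
    unfolding J_def
  proof (intro integral_mono)
    show "max 0 ((norm x)\<^sup>2 - a) - 3 * d * (if (norm x)\<^sup>2 > a then 1 else 0) \<le> (profile d ((norm x)\<^sup>2 - a))\<^sup>2"
      for x :: "real^2"
      using profile_square_close(2)[OF d_pos, of "(norm x)\<^sup>2 - a"] by (auto split: if_splits)
  qed (intro Bochner_Integration.integrable_diff integrable_mult_right integrable_basic)+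
  then show ?thesis
    by (subst (asm) Bochner_Integration.integral_diff)
      (auto simp only: integral_max integral_annulus integral_mult_right_zero integrable_basic intro!: integrable_mult_right)
qed

lemma J_ge: "pi * \<l>\<^sup>2 / 4 \<le> J" and J_pos: "J > 0"
proof -
  have "3 * d * (pi * \<l>) = 3 * \<epsilon> * (pi * \<l>\<^sup>2)" by (simp add: d_def power2_eq_square)
  \<comment> \<open>Here \<epsilon> <= 1/12 is used: the loss is at most half of the unregularised
    mass.\<close>
  also have "\<dots> \<le> 1 / 4 * (pi * \<l>\<^sup>2)" using \<epsilon>_le by (intro mult_right_mono) auto
  finally show "pi * \<l>\<^sup>2 / 4 \<le> J" using J_ge_difference by linarith
  moreover have "pi * \<l>\<^sup>2 / 4 > 0" using l_pos by simp
  ultimately show "J > 0" by linarith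
qed

section \<open>The normalised trial profile\<close>

lemma f_square: "(f u)\<^sup>2 = (profile d (u - a))\<^sup>2 / J" "(f' u)\<^sup>2 = (profile_deriv d (u - a))\<^sup>2 / J"
  using J_pos by (simp_all add: f_def f'_def power_divide)

lemma f_zero: "u \<le> a \<Longrightarrow> f u = 0" "u \<le> a \<Longrightarrow> f' u = 0"
  by (simp_all add: f_def f'_def)

lemma f_has_real_derivative: "(f has_real_derivative f' u) (at u)"
proof -
  have "((\<lambda>u. u - a) has_real_derivative 1) (at u)"
    by (auto intro!: derivative_eq_intros)
  from DERIV_chain2[OF profile_has_real_derivative[OF d_pos] this]
  have "((\<lambda>u. profile d (u - a)) has_real_derivative profile_deriv d (u - a)) (at u)"
    by simp
  then show ?thesis unfolding f_def[abs_def] f'_def by (rule DERIV_cdivide)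
qed

lemma integral_f_square: "(LINT x|D. (f ((norm x)\<^sup>2))\<^sup>2) = 1"
  using J_pos by (simp add: f_square J_def[symmetric])

lemma integrable_f_square [simp]: "integrable D (\<lambda>x. (f ((norm x)\<^sup>2))\<^sup>2)"
  unfolding f_square by simp

text \<open>The error is \<epsilon> relative to the height 2 / (pi \<open>\<l>\<close>) of
  \<open>q\<close>: the numerator is off by at most 3 d, and the normalisation by a relative amount
  of at most 6 \<epsilon>.\<close>

lemma f_square_close:
  assumes "u \<le> 1"
  shows "\<bar>(f u)\<^sup>2 - q u\<bar> \<le> 36 * \<epsilon> / (pi * \<l>)"
proof (cases "u \<le> a")
  case True
  then show ?thesis using l_pos \<epsilon>_pos by (simp add: f_zero q_eq)
next
  case False
  define p where "p = u - a"
  define m where "m = pi * \<l>\<^sup>2 / 2"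
  define h where "h = (profile d p)\<^sup>2"
  have p: "p > 0" "p \<le> \<l>" using False assms by (auto simp: p_def a_def)
  have m: "m > 0" using l_pos by (simp add: m_def)
  have J: "J \<le> m" "m / 2 \<le> J" "m - J \<le> 3 * d * (pi * \<l>)"
    using J_le J_ge J_ge_difference by (auto simp: m_def)
  have h: "\<bar>h - p\<bar> \<le> 3 * d"
    using profile_square_close[OF d_pos, of p] p d_pos by (auto simp: h_def)
  have inv: "1 / J \<le> 2 / m" using J m by (simp add: field_simps)
  \<comment> \<open>h / J - p / m splits into the error of the numerator and that of the
    normalisation.\<close>
  have "(f u)\<^sup>2 - q u = (h - p) * (1 / J) + p * ((m - J) * ((1 / J) * (1 / m)))"
    using p m J_pos by (simp add: f_square q_eq h_def field_simps flip: p_def m_def)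
  also have "\<bar>\<dots>\<bar> \<le> \<bar>h - p\<bar> * (1 / J) + p * ((m - J) * ((1 / J) * (1 / m)))"
    using p m J_pos J by (intro order_trans[OF abs_triangle_ineq] add_mono) (simp_all add: abs_mult)
  \<comment> \<open>In units of \<epsilon> / (pi \<open>\<l>\<close>) the two summands are 12 and
    24.\<close>
  also have "\<dots> \<le> 3 * d * (2 / m) + \<l> * ((3 * d * (pi * \<l>)) * ((2 / m) * (1 / m)))"
    using p m J_pos J h inv d_pos l_pos by (intro add_mono mult_mono) auto
  also have "\<dots> = 36 * \<epsilon> / (pi * \<l>)"
    using l_pos by (simp add: m_def d_def power2_eq_square field_simps)
  finally show ?thesis .
qed

lemma f'_square_le: "(f' u)\<^sup>2 \<le> 4 / J * (if u > a then 1 / (u - a + d) else 0)"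
proof -
  have "(profile_deriv d (u - a))\<^sup>2 \<le> 4 * (if u > a then 1 / (u - a + d) else 0)"
    using profile_deriv_square_le[OF d_pos, of "u - a"] by (auto split: if_splits)
  then have "(profile_deriv d (u - a))\<^sup>2 / J \<le> 4 * (if u > a then 1 / (u - a + d) else 0) / J"
    using J_pos by (intro divide_right_mono) auto
  then show ?thesis unfolding f_square by simp
qed

text \<open>These bounds depend on \<epsilon> and serve only for membership in the Sobolev space and
  integrability; adding the two roots gives one constant for both functions.\<close>

lemma f_bounded: 
  assumes "u \<le> 1"
  shows "\<bar>f u\<bar> \<le> sqrt (1 / J) + sqrt (4 / J * (1 / d))" "\<bar>f' u\<bar> \<le> sqrt (1 / J) + sqrt (4 / J * (1 / d))"
proof -
  have "(f u)\<^sup>2 \<le> 1 / J"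
    unfolding f_square using profile_square_close(1)[OF d_pos, of "u - a"] assms a_bounds J_pos
    by (intro divide_right_mono) auto
  then have 1: "\<bar>f u\<bar> \<le> sqrt (1 / J)" by (rule real_le_rsqrt[of "\<bar>f u\<bar>", simplified])
  have "(f' u)\<^sup>2 \<le> 4 / J * (1 / d)"
    using J_pos d_pos
    by (intro order_trans[OF f'_square_le] mult_left_mono) (auto intro!: divide_left_mono mult_pos_pos)
  then have 2: "\<bar>f' u\<bar> \<le> sqrt (4 / J * (1 / d))" by (rule real_le_rsqrt[of "\<bar>f' u\<bar>", simplified])
  have "sqrt (1 / J) \<ge> 0" "sqrt (4 / J * (1 / d)) \<ge> 0" using J_pos d_pos by auto
  with 1 2 show "\<bar>f u\<bar> \<le> sqrt (1 / J) + sqrt (4 / J * (1 / d))" "\<bar>f' u\<bar> \<le> sqrt (1 / J) + sqrt (4 / J * (1 / d))"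
    by linarith+
qed

lemma trial_H1: "H1_on unit_disc (vortex f k) (vortex_grad f f' k)"
  by (rule vortex_H1[where a=a]) (use a_bounds f_has_real_derivative f_zero f_bounded in auto)

lemma trial_norm: "L2_norm_on unit_disc (vortex f k) = 1"
  unfolding L2_norm_on_eq_1_iff using a_bounds
  by (subst norm_vortex) (auto simp: f_zero integral_f_square)

section \<open>Energy density of the trial function\<close>

definition "gp_density u =
  4 * u * (f' u)\<^sup>2 + (real n)\<^sup>2 * (f u)\<^sup>2 / u - \<Omega> * real n * (f u)\<^sup>2 + ((f u)\<^sup>2)\<^sup>2 / \<epsilon>\<^sup>2"

lemma GP_functional_trial:
  "GP_functional \<Omega> \<epsilon> (vortex f n) (vortex_grad f f' n) = (LINT x|D. gp_density ((norm x)\<^sup>2))"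
proof -
  have z: "f 0 = 0" "f' 0 = 0" using a_bounds by (auto simp: f_zero)
  have 4: "cmod (vortex f n x) ^ 4 = ((f ((norm x)\<^sup>2))\<^sup>2)\<^sup>2" for x
    unfolding norm_vortex[of f n x, OF z(1), symmetric] by (simp flip: power_mult)
  have "GP_functional \<Omega> \<epsilon> (vortex f n) (vortex_grad f f' n) =
      Re (LINT x|D. complex_of_real (gp_density ((norm x)\<^sup>2)))"
    unfolding GP_functional_def gp_density_def ang_mom_vortex[of f, OF z(1)] norm_vortex_grad[of f f', OF z] 4
    by (simp add: mult_ac)
  then show ?thesis by simp
qed

lemma integrable_gp_density: "integrable D (\<lambda>x. gp_density ((norm x)\<^sup>2))"
proof -
  have z: "f 0 = 0" "f' 0 = 0" using a_bounds by (auto simp: f_zero)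
  have "integrable D (\<lambda>x. (norm (vortex_grad f f' n x))\<^sup>2)"
    using trial_H1 by (simp add: H1_on_def L2_on_def)
  moreover have "integrable D (\<lambda>x. ((f ((norm x)\<^sup>2))\<^sup>2)\<^sup>2)"
  proof (rule integrable_radial_bounded[where g="\<lambda>u. ((f u)\<^sup>2)\<^sup>2"])
    show "\<bar>((f u)\<^sup>2)\<^sup>2\<bar> \<le> (sqrt (1 / J) + sqrt (4 / J * (1 / d))) ^ 4" if "u \<le> 1" for u
      using power_mono[OF f_bounded(1)[OF that] abs_ge_zero, of 4] by (simp flip: power_mult)
  qed measurable
  ultimately have "integrable D (\<lambda>x. (norm (vortex_grad f f' n x))\<^sup>2 - \<Omega> * real n * (f ((norm x)\<^sup>2))\<^sup>2 + ((f ((norm x)\<^sup>2))\<^sup>2)\<^sup>2 / \<epsilon>\<^sup>2)"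
    by (intro Bochner_Integration.integrable_add Bochner_Integration.integrable_diff integrable_mult_right integrable_divide) auto
  then show ?thesis unfolding gp_density_def norm_vortex_grad[of f f', OF z] by simp
qed

text \<open>Two squares are completed, one in the winding number and one in the density around
  \<open>q\<close>. The remaining terms in f^2 and q^2 integrate to \<open>E\<^sub>0\<close> and an
  error of order \<open>s\<close>.\<close>

lemma gp_density_le:
  assumes "0 \<le> u" "u \<le> 1"
  shows "\<epsilon>\<^sup>2 * s * gp_density u \<le>
    \<epsilon>\<^sup>2 * s * (16 / J) * (if u > a then 1 / (u - a + d) else 0)
    + (4 * \<epsilon>\<^sup>2 * s + \<Omega>\<^sub>1\<^sup>2 * \<l>\<^sup>2 - \<Omega>\<^sub>1\<^sup>2 * a / 4) * (f u)\<^sup>2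
    + s * (36 * \<epsilon> / (pi * \<l>))\<^sup>2 - s * (q u)\<^sup>2"
proof (cases "u \<le> a")
  case True
  then show ?thesis using s_pos by (simp add: gp_density_def f_zero q_def)
next
  case False
  define F where "F = (f u)\<^sup>2"
  have F: "F \<ge> 0" by (simp add: F_def)
  have u: "u \<ge> 1 / 2" "u > 0" using False a_bounds by auto
  have kin: "4 * u * (f' u)\<^sup>2 \<le> 16 / J * (if u > a then 1 / (u - a + d) else 0)"
  proof -
    have "u * (f' u)\<^sup>2 \<le> 1 * (f' u)\<^sup>2" using assms by (intro mult_right_mono) auto
    then show ?thesis using f'_square_le[of u] by simp
  qed
  have rot: "(real n - \<Omega> * u / 2)\<^sup>2 / u \<le> 4 + \<Omega>\<^sup>2 * \<l>\<^sup>2"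
  proof -
    \<comment> \<open>Two deviations add up: rounding of \<open>n\<close>, and 1 - u <=
      \<open>\<l>\<close> on the annulus. The final division by u costs a factor 2.\<close>
    have "\<bar>real n - \<Omega> / 2\<bar> \<le> 1" using scaling(3) unfolding n_def by linarith
    moreover have "0 \<le> \<Omega> / 2 * (1 - u)" "\<Omega> / 2 * (1 - u) \<le> \<Omega> / 2 * \<l>"
      using scaling(3) assms False by (auto simp: a_def intro!: mult_left_mono)
    ultimately have "\<bar>real n - \<Omega> * u / 2\<bar> \<le> 1 + \<Omega> * \<l> / 2" by (simp add: algebra_simps)
    then have "(real n - \<Omega> * u / 2)\<^sup>2 \<le> (1 + \<Omega> * \<l> / 2)\<^sup>2"
      using power_mono[OF _ abs_ge_zero, of _ _ 2] by fastforce
    also have "\<dots> \<le> 2 + \<Omega>\<^sup>2 * \<l>\<^sup>2 / 2"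
      using zero_le_power2[of "1 - \<Omega> * \<l> / 2"] by (simp add: power2_eq_square algebra_simps)
    also have "\<dots> \<le> (4 + \<Omega>\<^sup>2 * \<l>\<^sup>2) * u"
      using mult_left_mono[OF u(1), of "4 + \<Omega>\<^sup>2 * \<l>\<^sup>2"] by simp
    finally show ?thesis using u by (simp add: divide_le_eq)
  qed
  have "gp_density u = 4 * u * (f' u)\<^sup>2 + (real n - \<Omega> * u / 2)\<^sup>2 / u * F - \<Omega>\<^sup>2 * u / 4 * F + F\<^sup>2 / \<epsilon>\<^sup>2"
    unfolding gp_density_def F_def[symmetric] using u by (simp add: field_simps power2_eq_square)
  also have "\<dots> \<le> 16 / J * (if u > a then 1 / (u - a + d) else 0) + (4 + \<Omega>\<^sup>2 * \<l>\<^sup>2) * F - \<Omega>\<^sup>2 * u / 4 * F + F\<^sup>2 / \<epsilon>\<^sup>2"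
    by (intro add_mono diff_mono kin mult_right_mono rot F order_refl)
  finally have "\<epsilon>\<^sup>2 * s * gp_density u \<le> \<epsilon>\<^sup>2 * s * (16 / J * (if u > a then 1 / (u - a + d) else 0) + (4 + \<Omega>\<^sup>2 * \<l>\<^sup>2) * F - \<Omega>\<^sup>2 * u / 4 * F + F\<^sup>2 / \<epsilon>\<^sup>2)"
    using s_pos by (intro mult_left_mono) auto
  also have "\<dots> = \<epsilon>\<^sup>2 * s * (16 / J) * (if u > a then 1 / (u - a + d) else 0)
     + 4 * \<epsilon>\<^sup>2 * s * F + (\<epsilon>\<^sup>2 * s * \<Omega>\<^sup>2) * \<l>\<^sup>2 * F - (\<epsilon>\<^sup>2 * s * \<Omega>\<^sup>2) * u / 4 * F + s * F\<^sup>2"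
    using \<epsilon>_pos by (simp add: algebra_simps)
  \<comment> \<open>Writing u = a + (u - a) separates the part proportional to the mass from the
    potential that \<open>q\<close> balances.\<close>
  also have "\<dots> = \<epsilon>\<^sup>2 * s * (16 / J) * (if u > a then 1 / (u - a + d) else 0)
     + (4 * \<epsilon>\<^sup>2 * s + \<Omega>\<^sub>1\<^sup>2 * \<l>\<^sup>2 - \<Omega>\<^sub>1\<^sup>2 * a / 4) * F + (s * F\<^sup>2 - \<Omega>\<^sub>1\<^sup>2 / 4 * (u - a) * F)"
    unfolding scaling by (simp add: field_simps)
  also have "s * F\<^sup>2 - \<Omega>\<^sub>1\<^sup>2 / 4 * (u - a) * F = s * (F - q u)\<^sup>2 - s * (q u)\<^sup>2"
  proof -
    \<comment> \<open>The Euler-Lagrange equation of the TF problem on the support of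
      \<open>q\<close>.\<close>
    have "\<Omega>\<^sub>1\<^sup>2 / 4 * (u - a) = 2 * s * q u" using False s_pos by (simp add: q_def)
    then show ?thesis by (simp add: power2_eq_square algebra_simps)
  qed
  also have "s * (F - q u)\<^sup>2 \<le> s * (36 * \<epsilon> / (pi * \<l>))\<^sup>2"
    using power_mono[OF f_square_close[OF assms(2)] abs_ge_zero, of 2] s_pos
    by (intro mult_left_mono) (auto simp: F_def)
  finally show ?thesis by (simp add: F_def)
qed

text \<open>The first bound follows from 1 + 1/\<epsilon> <= 1/\<epsilon>^2; the second absorbs
  plain \<epsilon>^2 into \<epsilon>^2 |ln \<epsilon>|.\<close>

lemma ln_bounds: "ln (1 + 1 / \<epsilon>) \<le> 2 * \<bar>ln \<epsilon>\<bar>" "1 \<le> \<bar>ln \<epsilon>\<bar>"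
proof -
  have "ln (1 + 1 / \<epsilon>) \<le> ln ((1 / \<epsilon>)\<^sup>2)"
  proof (subst ln_le_cancel_iff)
    have "1 + 1 / \<epsilon> = (\<epsilon>\<^sup>2 + \<epsilon>) / \<epsilon>\<^sup>2"
      using \<epsilon>_pos by (simp add: field_simps power2_eq_square)
    also have "\<dots> \<le> 1 / \<epsilon>\<^sup>2"
      using \<epsilon>_pos \<epsilon>_le mult_mono[of \<epsilon> "1/12" \<epsilon> "1/12"]
      by (intro divide_right_mono) (auto simp: power2_eq_square)
    finally show "1 + 1 / \<epsilon> \<le> (1 / \<epsilon>)\<^sup>2" by (simp add: power_divide)
  qed (use \<epsilon>_pos in \<open>auto intro: add_pos_pos\<close>)
  also have "\<dots> = - 2 * ln \<epsilon>" using \<epsilon>_pos by (simp add: ln_realpow ln_div)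
  finally show "ln (1 + 1 / \<epsilon>) \<le> 2 * \<bar>ln \<epsilon>\<bar>" by linarith
  have "12 \<le> 1 / \<epsilon>" using \<epsilon>_pos \<epsilon>_le by (simp add: field_simps)
  then have "exp 1 \<le> 1 / \<epsilon>" using e_less_272 by linarith
  then have "ln (exp 1) \<le> ln (1 / \<epsilon>)" using \<epsilon>_pos by (subst ln_le_cancel_iff) auto
  then show "1 \<le> \<bar>ln \<epsilon>\<bar>" using \<epsilon>_pos by (simp add: ln_div)
qed

text \<open>The four constants come, in this order, from the gradient of the profile, from replacing
  \<open>q\<close> by f^2, from rounding the winding number, and from the thickness of the
  annulus.\<close>

definition "err = (8 * pi * \<Omega>\<^sub>1\<^sup>2 + 81 * \<Omega>\<^sub>1\<^sup>2 + 4 + 16 / pi) * (s + \<epsilon>\<^sup>2 * \<bar>ln \<epsilon>\<bar>)"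

lemma trial_energy:
  "\<epsilon> powr (2 + 2 * \<alpha>) * GP_functional \<Omega> \<epsilon> (vortex f n) (vortex_grad f f' n) \<le> E\<^sub>0 + err"
proof -
  define c where "c = 4 * \<epsilon>\<^sup>2 * s + \<Omega>\<^sub>1\<^sup>2 * \<l>\<^sup>2 - \<Omega>\<^sub>1\<^sup>2 * a / 4"
  define b where "b = s * (36 * \<epsilon> / (pi * \<l>))\<^sup>2"
  have [simp]: "integrable D (\<lambda>x. b)"
    by (rule integrable_radial_bounded[where g="\<lambda>_. b" and B="\<bar>b\<bar>"]) auto
  have area: "measure lebesgue unit_disc = pi"
    by (simp add: content_ball unit_ball_vol_2)
  \<comment> \<open>Stated for abstract integrands, so that simplification splits the integral
    without rewriting them.\<close>
  have lin: "(LINT x|D. k * A x + c * B x + b - s * Q x) =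
      k * (LINT x|D. A x) + c * (LINT x|D. B x) + pi * b - s * (LINT x|D. Q x)"
    if "integrable D A" "integrable D B" "integrable D Q" for k and A B Q :: "real^2 \<Rightarrow> real"
    using that by (simp add: measure_restrict_space area)
  have "\<epsilon> powr (2 + 2 * \<alpha>) * GP_functional \<Omega> \<epsilon> (vortex f n) (vortex_grad f f' n) =
     (LINT x|D. \<epsilon>\<^sup>2 * s * gp_density ((norm x)\<^sup>2))"
    by (simp add: GP_functional_trial scaling)
  also have "\<dots> \<le> (LINT x|D. \<epsilon>\<^sup>2 * s * (16 / J) * (if (norm x)\<^sup>2 > a then 1 / ((norm x)\<^sup>2 - a + d) else 0)
    + c * (f ((norm x)\<^sup>2))\<^sup>2 + b - s * (q ((norm x)\<^sup>2))\<^sup>2)"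
  proof (rule integral_mono)
    fix x assume "x \<in> space D"
    then have "0 \<le> (norm x)\<^sup>2" "(norm x)\<^sup>2 \<le> 1" by (auto simp: power_le_one)
    from gp_density_le[OF this] show "\<epsilon>\<^sup>2 * s * gp_density ((norm x)\<^sup>2) \<le> \<epsilon>\<^sup>2 * s * (16 / J) * (if (norm x)\<^sup>2 > a then 1 / ((norm x)\<^sup>2 - a + d) else 0)
    + c * (f ((norm x)\<^sup>2))\<^sup>2 + b - s * (q ((norm x)\<^sup>2))\<^sup>2" unfolding b_def c_def .
  qed (intro Bochner_Integration.integrable_add Bochner_Integration.integrable_diff integrable_mult_right
      integrable_gp_density integrable_basic integrable_f_square; simp)+
  also have "\<dots> = \<epsilon>\<^sup>2 * s * (16 / J) * (pi * ln (1 + 1 / \<epsilon>)) + c + pi * b - s * (LINT x|D. (q ((norm x)\<^sup>2))\<^sup>2)"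
    unfolding lin[OF integrable_basic(3) integrable_f_square integrable_basic(5)]
      integral_inverse integral_f_square by simp
  also have "\<dots> = E\<^sub>0 + \<epsilon>\<^sup>2 * s * (16 / J) * (pi * ln (1 + 1 / \<epsilon>)) + 4 * \<epsilon>\<^sup>2 * s + \<Omega>\<^sub>1\<^sup>2 * \<l>\<^sup>2 + pi * b"
    by (simp add: E\<^sub>0_def c_def)
  also have "\<epsilon>\<^sup>2 * s * (16 / J) * (pi * ln (1 + 1 / \<epsilon>)) \<le> \<epsilon>\<^sup>2 * s * (16 / (pi * \<l>\<^sup>2 / 4)) * (pi * (2 * \<bar>ln \<epsilon>\<bar>))"
    using J_ge J_pos l_pos s_pos \<epsilon>_pos ln_bounds(1)
    by (intro mult_mono divide_left_mono mult_nonneg_nonneg mult_pos_pos) auto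
  \<comment> \<open>The factor \<open>\<l>\<^sup>2\<close> in \<open>s\<close> cancels the one from
    the mass of the profile, so no power of the thickness remains.\<close>
  also have "\<dots> = 8 * pi * \<Omega>\<^sub>1\<^sup>2 * (\<epsilon>\<^sup>2 * \<bar>ln \<epsilon>\<bar>)"
    using l_pos by (simp add: s_eq field_simps)
  also have "\<Omega>\<^sub>1\<^sup>2 * \<l>\<^sup>2 = 16 / pi * s"
    by (simp add: s_eq)
  also have "pi * b = 81 * \<Omega>\<^sub>1\<^sup>2 * \<epsilon>\<^sup>2"
    using l_pos by (simp add: b_def s_eq power2_eq_square)
  also have "81 * \<Omega>\<^sub>1\<^sup>2 * \<epsilon>\<^sup>2 \<le> 81 * \<Omega>\<^sub>1\<^sup>2 * (\<epsilon>\<^sup>2 * \<bar>ln \<epsilon>\<bar>)"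
    using ln_bounds(2) mult_left_mono[of 1 "\<bar>ln \<epsilon>\<bar>" "\<epsilon>\<^sup>2"] by (intro mult_left_mono) auto
  also have "4 * \<epsilon>\<^sup>2 * s \<le> 4 * s"
    using \<epsilon>_pos \<epsilon>_le s_pos power_le_one[of \<epsilon> 2] mult_right_mono[of "\<epsilon>\<^sup>2" 1 s] by simp
  also have "E\<^sub>0 + 8 * pi * \<Omega>\<^sub>1\<^sup>2 * (\<epsilon>\<^sup>2 * \<bar>ln \<epsilon>\<bar>) + 4 * s + 16 / pi * s + 81 * \<Omega>\<^sub>1\<^sup>2 * (\<epsilon>\<^sup>2 * \<bar>ln \<epsilon>\<bar>) \<le> E\<^sub>0 + err"
  proof -
    have "0 \<le> (8 * pi * \<Omega>\<^sub>1\<^sup>2 + 81 * \<Omega>\<^sub>1\<^sup>2) * s + (4 + 16 / pi) * (\<epsilon>\<^sup>2 * \<bar>ln \<epsilon>\<bar>)"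
      using s_pos by simp
    then show ?thesis by (simp add: err_def algebra_simps)
  qed
  finally show ?thesis by simp
qed

section \<open>The TF minimum and the final comparison\<close>

lemma TF_admissible_ge:
  assumes "L2_on unit_disc \<rho>" "AE x in D. 0 \<le> \<rho> x" "(LINT x|D. \<rho> x) = 1"
  shows "E\<^sub>0 \<le> TF_functional \<Omega>\<^sub>1 \<alpha> \<epsilon> \<rho>"
  unfolding E\<^sub>0_def by (rule TF_functional_lower_bound[OF s_def \<epsilon>_pos assms]) (rule q_def)

lemma TF_energy_le:
  assumes "L2_on unit_disc \<rho>" "AE x in D. 0 \<le> \<rho> x" "(LINT x|D. \<rho> x) = 1"
  shows "TF_energy \<Omega>\<^sub>1 \<alpha> \<epsilon> \<le> TF_functional \<Omega>\<^sub>1 \<alpha> \<epsilon> \<rho>"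
  unfolding TF_energy_def
  by (rule cInf_lower) (use assms TF_admissible_ge in \<open>auto intro!: bdd_belowI[of _ E\<^sub>0]\<close>)

text \<open>Shows that admissible densities exist and that the TF energy is at most 0.\<close>

lemma constant_density:
  "L2_on unit_disc (\<lambda>_. 1 / pi)" "(LINT x|D. 1 / pi) = 1" "TF_functional \<Omega>\<^sub>1 \<alpha> \<epsilon> (\<lambda>_. 1 / pi) \<le> 0"
proof -
  have area: "measure D unit_disc = pi"
    by (simp add: measure_restrict_space content_ball unit_ball_vol_2)
  have i: "integrable D (\<lambda>x. c)" for c :: real
    by (rule integrable_radial_bounded[where g="\<lambda>_. c" and B="\<bar>c\<bar>"]) auto
  have i2: "integrable D (\<lambda>x. (norm x)\<^sup>2)"
    by (rule integrable_radial_bounded[where g="\<lambda>u. u" and B=1]) auto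
  show "L2_on unit_disc (\<lambda>_. 1 / pi)" unfolding L2_on_def using i by auto
  show "(LINT x|D. 1 / pi) = 1" by (simp add: area)
  have m: "(LINT x|D. (norm x)\<^sup>2) = pi / 2"
  proof -
    have "(LINT x|D. (norm x)\<^sup>2) = (LINT x|D. (if (norm x)\<^sup>2 > 0 then (norm x)\<^sup>2 else 0))"
      by (intro Bochner_Integration.integral_cong) auto
    also have "\<dots> = pi * (1\<^sup>2 / 2 - 0\<^sup>2 / 2)"
      by (rule lebesgue_integral_radial_FTC) (auto intro!: derivative_eq_intros)
    finally show ?thesis by simp
  qed
  have "TF_functional \<Omega>\<^sub>1 \<alpha> \<epsilon> (\<lambda>_. 1 / pi) = s * (LINT x|D. (1 / pi)\<^sup>2 - \<Omega>\<^sub>1\<^sup>2 / (4 * s * pi) * (norm x)\<^sup>2)"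
    unfolding TF_functional_def s_def[symmetric] by (simp add: mult_ac)
  also have "\<dots> = s * (pi * (1 / pi)\<^sup>2 - \<Omega>\<^sub>1\<^sup>2 / (4 * s * pi) * (pi / 2))"
    using i i2 by (simp add: area m)
  also have "\<dots> = s / pi - \<Omega>\<^sub>1\<^sup>2 / 8"
    using s_pos by (simp add: field_simps power2_eq_square)
  also have "\<dots> = \<Omega>\<^sub>1\<^sup>2 * (\<l>\<^sup>2 / 16 - 1 / 8)"
    by (simp add: s_eq algebra_simps)
  also have "\<dots> \<le> 0"
    using l_pos l_le power_le_one[of \<l> 2] by (intro mult_nonneg_nonpos) auto
  finally show "TF_functional \<Omega>\<^sub>1 \<alpha> \<epsilon> (\<lambda>_. 1 / pi) \<le> 0" .
qed

text \<open>The chain \<open>E\<^sub>0\<close> <= TF energy <= scaled GP energy <=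
  \<open>E\<^sub>0 + err\<close> gives the estimate without evaluating the TF energy.\<close>

lemma energy_difference:
  "\<bar>\<epsilon> powr (2 + 2 * \<alpha>) * GP_energy \<Omega> \<epsilon> - TF_energy \<Omega>\<^sub>1 \<alpha> \<epsilon>\<bar> \<le> err"
proof -
  let ?e = "\<epsilon> powr (2 + 2 * \<alpha>)"
  let ?S = "{GP_functional \<Omega> \<epsilon> \<Psi> G | \<Psi> G. H1_on unit_disc \<Psi> G \<and> L2_norm_on unit_disc \<Psi> = 1}"
  have e: "?e > 0" using \<epsilon>_pos by simp
  \<comment> \<open>Settles the case in which the GP functional takes the default value 0.\<close>
  have "TF_energy \<Omega>\<^sub>1 \<alpha> \<epsilon> \<le> 0"
    using TF_energy_le[OF constant_density(1) _ constant_density(2)] constant_density(3) by auto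
  have E0: "E\<^sub>0 \<le> TF_energy \<Omega>\<^sub>1 \<alpha> \<epsilon>"
    unfolding TF_energy_def
  proof (rule cInf_greatest)
    have "TF_functional \<Omega>\<^sub>1 \<alpha> \<epsilon> (\<lambda>_. 1 / pi) \<in> {TF_functional \<Omega>\<^sub>1 \<alpha> \<epsilon> \<rho> | \<rho>.
            L2_on unit_disc \<rho> \<and> (AE x in D. 0 \<le> \<rho> x) \<and> (LINT x|D. \<rho> x) = 1}"
      using constant_density by (intro CollectI exI[of _ "\<lambda>_. 1 / pi"]) auto
    then show "{TF_functional \<Omega>\<^sub>1 \<alpha> \<epsilon> \<rho> | \<rho>.
            L2_on unit_disc \<rho> \<and> (AE x in D. 0 \<le> \<rho> x) \<and> (LINT x|D. \<rho> x) = 1} \<noteq> {}" by blast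
  qed (use TF_admissible_ge in auto)
  have ge: "TF_energy \<Omega>\<^sub>1 \<alpha> \<epsilon> / ?e \<le> GP_functional \<Omega> \<epsilon> \<Psi> G"
    if H: "H1_on unit_disc \<Psi> G" "L2_norm_on unit_disc \<Psi> = 1" for \<Psi> G
  proof -
    have "TF_energy \<Omega>\<^sub>1 \<alpha> \<epsilon> \<le> ?e * GP_functional \<Omega> \<epsilon> \<Psi> G"
      using GP_functional_ge_TF_functional[OF \<epsilon>_pos H, of \<Omega>\<^sub>1 \<alpha>, folded \<Omega>_def]
    proof (elim disjE)
      assume "L2_on unit_disc (\<lambda>x. (cmod (\<Psi> x))\<^sup>2) \<and>
        TF_functional \<Omega>\<^sub>1 \<alpha> \<epsilon> (\<lambda>x. (cmod (\<Psi> x))\<^sup>2) \<le> ?e * GP_functional \<Omega> \<epsilon> \<Psi> G"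
      then show ?thesis
        using TF_energy_le[of "\<lambda>x. (cmod (\<Psi> x))\<^sup>2"] H(2) unfolding L2_norm_on_eq_1_iff by auto
    qed (use \<open>TF_energy \<Omega>\<^sub>1 \<alpha> \<epsilon> \<le> 0\<close> in simp)
    then show ?thesis using e by (simp add: divide_le_eq mult.commute)
  qed
  have trial: "GP_functional \<Omega> \<epsilon> (vortex f n) (vortex_grad f f' n) \<in> ?S"
    using trial_H1 trial_norm by blast
  have "TF_energy \<Omega>\<^sub>1 \<alpha> \<epsilon> / ?e \<le> GP_energy \<Omega> \<epsilon>"
    unfolding GP_energy_def by (rule cInf_greatest) (use trial ge in auto)
  then have lower: "TF_energy \<Omega>\<^sub>1 \<alpha> \<epsilon> \<le> ?e * GP_energy \<Omega> \<epsilon>"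
    using e by (simp add: divide_le_eq mult.commute)
  have "GP_energy \<Omega> \<epsilon> \<le> GP_functional \<Omega> \<epsilon> (vortex f n) (vortex_grad f f' n)"
    unfolding GP_energy_def
    by (rule cInf_lower[OF trial]) (use ge in \<open>auto intro!: bdd_belowI[of _ "TF_energy \<Omega>\<^sub>1 \<alpha> \<epsilon> / ?e"]\<close>)
  then have "?e * GP_energy \<Omega> \<epsilon> \<le> ?e * GP_functional \<Omega> \<epsilon> (vortex f n) (vortex_grad f f' n)"
    using e by simp
  with trial_energy E0 lower show ?thesis by linarith
qed

end

theorem theorem2p2:
  fixes \<Omega>\<^sub>1 \<alpha> :: real
  assumes "\<Omega>\<^sub>1 > 0" and "\<alpha> > 0"
  shows "\<exists>C>0. \<exists>\<epsilon>\<^sub>0>0. \<forall>\<epsilon>::real. 0 < \<epsilon> \<and> \<epsilon> < \<epsilon>\<^sub>0 \<longrightarrow>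
    \<bar>\<epsilon> powr (2 + 2 * \<alpha>) * GP_energy (\<Omega>\<^sub>1 / \<epsilon> powr (1 + \<alpha>)) \<epsilon> - TF_energy \<Omega>\<^sub>1 \<alpha> \<epsilon>\<bar>
      \<le> C * (\<epsilon> powr (2 * \<alpha>) + \<epsilon>\<^sup>2 * \<bar>ln \<epsilon>\<bar>)"
proof -
  define C where "C = 8 * pi * \<Omega>\<^sub>1\<^sup>2 + 81 * \<Omega>\<^sub>1\<^sup>2 + 4 + 16 / pi"
  \<comment> \<open>Chosen so that b to the power \<alpha> turns the thinness condition
    \<open>thin\<close> into an equality.\<close>
  define b where "b = (sqrt pi * \<Omega>\<^sub>1 / 8) powr (1 / \<alpha>)"
  have C: "C > 0" unfolding C_def by (intro add_nonneg_pos add_pos_pos) auto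
  have b: "b > 0" using assms by (simp add: b_def)
  show ?thesis
  proof (rule exI[of _ C], rule conjI[OF C], rule exI[of _ "min (1 / 12) b"], intro conjI allI impI)
    fix \<epsilon> :: real
    assume \<epsilon>: "0 < \<epsilon> \<and> \<epsilon> < min (1 / 12) b"
    have "\<epsilon> powr \<alpha> \<le> b powr \<alpha>" using \<epsilon> assms by (intro powr_mono2) auto
    also have "b powr \<alpha> = sqrt pi * \<Omega>\<^sub>1 / 8" using assms by (simp add: b_def powr_powr)
    finally have "4 * \<epsilon> powr \<alpha> / (sqrt pi * \<Omega>\<^sub>1) \<le> 1 / 2"
      using assms by (simp add: divide_le_eq)
    then interpret TF_regime \<Omega>\<^sub>1 \<alpha> \<epsilon>
      using \<epsilon> assms by unfold_locales auto
    show "\<bar>\<epsilon> powr (2 + 2 * \<alpha>) * GP_energy (\<Omega>\<^sub>1 / \<epsilon> powr (1 + \<alpha>)) \<epsilon> - TF_energy \<Omega>\<^sub>1 \<alpha> \<epsilon>\<bar>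
      \<le> C * (\<epsilon> powr (2 * \<alpha>) + \<epsilon>\<^sup>2 * \<bar>ln \<epsilon>\<bar>)"
      using energy_difference unfolding \<Omega>_def err_def s_def C_def .
  qed (use b in auto)
qed

end
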